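(* Fix integers $1 \le p \le q$. Let $a_1,\ldots,a_p \in \mathbb{R} \setminus (-\mathbb{N})$ and $b_1,\ldots,b_p > 0$ be given. For further parameters $b_{p+1},\ldots,b_q$ write $\mathbf{a}=(a_1,\ldots,a_p)$ and $\mathbf{b}=(b_1,\ldots,b_q)$. Then the following are equivalent: (a) For all $b_{p+1},\ldots,b_q > 0$, the entire function ${}_pF_q(\mathbf{a};\mathbf{b};\,\cdot\,)$ has only real zeros. (a$'$) For all sufficiently large $b_{p+1},\ldots,b_q > 0$, ${}_pF_q(\mathbf{a};\mathbf{b};\,\cdot\,)$ has only real zeros. (a$''$) For some sequence of tuples $(b_{p+1},\ldots,b_q)$ of real numbers (none in $-\mathbb{N}$) tending to $+\infty$ in all coordinates, ${}_pF_q(\mathbf{a};\mathbf{b};\,\cdot\,)$ has only real zeros for every tuple in the sequence. (b) For all $b_{p+1},\ldots,b_q > 0$, ${}_pF_q(\mathbf{a};\mathbf{b};\,\cdot\,) \in LP^+$. (b$'$) For all sufficiently large $b_{p+1},\ldots,b_q > 0$, ${}_pF_q(\mathbf{a};\mathbf{b};\,\cdot\,) \in LP^+$. (b$''$) For some sequence of tuples $(b_{p+1},\ldots,b_q)$ of real numbers (none in $-\mathbb{N}$) tending to $+\infty$ in all coordinates, ${}_pF_q(\mathbf{a};\mathbf{b};\,\cdot\,) \in LP^+$ for every tuple in the sequence. (c) The $a_1,\ldots,a_p$ can be re-indexed so that $a_i = b_i + m_i$ for $1 \le i \le p$, with all $m_i \in \mathbb{N}$.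
   Context: Conventions: $\mathbb{N}=\{0,1,2,\ldots\}$ and $-\mathbb{N}=\{0,-1,-2,\ldots\}$. The hypergeometric function is ${}_pF_q(a_1,\ldots,a_p;b_1,\ldots,b_q;x)=\sum_{n=0}^\infty \frac{a_1^{\overline{n}}\cdots a_p^{\overline{n}}}{b_1^{\overline{n}}\cdots b_q^{\overline{n}}}\,\frac{x^n}{n!}$, where $a^{\overline{n}}=a(a+1)\cdots(a+n-1)$ (with $a^{\overline{0}}=1$) and all $b_j\notin -\mathbb{N}$. For $p\le q$ it is an entire function of $x\in\mathbb{C}$. "Only real zeros" means that every zero in $\mathbb{C}$ is real. A polynomial with complex coefficients is negative-real-rooted if it is either identically zero or has all its zeros in $(-\infty,0]$. The Laguerre--Pólya class $LP^+$ is the set of entire functions that are limits, uniformly on compact subsets of $\mathbb{C}$, of sequences of negative-real-rooted polynomials. "For all sufficiently large $b_{p+1},\ldots,b_q>0$" means: there is $B>0$ such that the assertion holds whenever $b_j\ge B$ for all $p+1\le j\le q$. When $p=q$ there are no parameters $b_{p+1},\ldots,b_q$, so (a), (a$'$), (a$''$) all simply say that ${}_pF_p(a_1,\ldots,a_p;b_1,\ldots,b_p;\,\cdot\,)$ has only real zeros, and (b), (b$'$), (b$''$) all simply say that it belongs to $LP^+$. *)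

theory Defs
  imports "HOL-Analysis.Analysis" "HOL-Combinatorics.Permutations"
begin

(* The last argument of fps_hypergeo rescales the variable, hence the 1. *)
definition hypergeo :: "'a :: {real_normed_field, banach} list \<Rightarrow> 'a list \<Rightarrow> 'a \<Rightarrow> 'a" where
  "hypergeo as bs x = eval_fps (fps_hypergeo as bs 1) x"

lemma hypergeo_series:
  "hypergeo as bs x =
     (\<Sum>n. (\<Prod>a\<leftarrow>as. pochhammer a n) / (\<Prod>b\<leftarrow>bs. pochhammer b n) * (x ^ n / fact n))"
proof -
  have fold: "foldl (\<lambda>r a. r * pochhammer a n) v xs = v * (\<Prod>a\<leftarrow>xs. pochhammer a n)"
    for n and v :: 'a and xs
    by (induction xs arbitrary: v) (simp_all add: mult.assoc)
  show ?thesis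
    by (simp add: hypergeo_def eval_fps_def fold)
qed

definition only_real_zeros :: "(complex \<Rightarrow> complex) \<Rightarrow> bool" where
  "only_real_zeros f \<longleftrightarrow> (\<forall>z. f z = 0 \<longrightarrow> z \<in> \<real>)"

definition negative_real_rooted :: "complex poly \<Rightarrow> bool" where
  "negative_real_rooted P \<longleftrightarrow> P = 0 \<or> (\<forall>z. poly P z = 0 \<longrightarrow> z \<in> \<real>\<^sub>\<le>\<^sub>0)"

definition LP_plus :: "(complex \<Rightarrow> complex) set" where
  "LP_plus = {f. f holomorphic_on UNIV \<and>
     (\<exists>P :: nat \<Rightarrow> complex poly. (\<forall>n. negative_real_rooted (P n)) \<and>
        (\<forall>K. compact K \<longrightarrow> uniform_limit K (\<lambda>n. poly (P n)) f sequentially))}"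

end

(*
For p = q the claim (a) ==> (c) rests on the hypergeometric differential equation: with
theta = z d/dz it becomes a first-order system whose coefficient matrix is, on the imaginary axis,
M / z plus a skew-Hermitian part, so f = pFp grows only polynomially there. If all zeros of f are
real, then |f(iy) f(-iy)| is at least the product of 1 + y^2/x^2 over any finite set of zeros x,
because f has exponential type. Hence f has finitely many zeros and f(z) = P(z) exp(beta z).
Comparing Taylor coefficients gives a polynomial Q with
Q(X + 1) prod (X + b_i) = Q(X) prod (X + a_i), and removing the roots of Q one at a time matches
the a_i with the b_i up to natural numbers. The case p < q reduces to this one by Hurwitz' theorem,
letting the additional parameters tend to infinity after rescaling z.

Conversely, LP+ contains exp and is closed under f -> beta f + z f' for beta > 0, since
Im (z / (z + rho)) >= 0 for Im z > 0 and rho >= 0. Iterating this multiplies the n-th coefficient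
by (c + m)_n / (c)_n, and a limit of such operators divides it by (c)_n.
*)
theory Submission
  imports Defs "HOL-Computational_Algebra.Fundamental_Theorem_Algebra"
    "HOL-Complex_Analysis.Complex_Analysis" "HOL-Real_Asymp.Real_Asymp"
begin

section \<open>Closure properties of the class LP+\<close>

text \<open>Pairing \<open>z\<close> with \<open>- z\<close> takes the place of Hadamard's
  factorization. For exponential type the product of the factors 1 - z/x need not converge, and
  exp(\<beta> z) has uncontrolled modulus on the imaginary axis as long as \<beta> may be any
  complex number. In f(z) f(-z) the odd part of the exponent cancels, so finitely many zeros can be
  handled at a time and no infinite product appears. Since the coefficients are real, f(-iy) is the
  conjugate of f(iy), and a growth estimate on one half of the imaginary axis suffices. The energy
  estimate behind that growth dictates the choice of the first-order system: theta^p f is traded for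
  the image of f under prod (theta + a_i), because then z occurs in a single diagonal entry. In the
  converse direction the positivity of b_i makes each number b_i + m an admissible \<beta> in f ->
  \<beta> f + z f'.\<close>

lemma uniform_limit_compactI:
  fixes f :: "complex \<Rightarrow> complex"
  assumes "\<And>R. R > 0 \<Longrightarrow> uniform_limit (cball 0 R) F f sequentially" and "compact K"
  shows "uniform_limit K F f sequentially"
proof -
  obtain R where "R > 0" "K \<subseteq> cball 0 R"
    using compact_imp_bounded[OF \<open>compact K\<close>] by (force simp: bounded_pos)
  then show ?thesis using assms(1) uniform_limit_on_subset by blast
qed

lemma LP_plusI:
  assumes "f holomorphic_on UNIV" and "\<And>n. negative_real_rooted (P n)"
    and "\<And>R. R > 0 \<Longrightarrow> uniform_limit (cball 0 R) (\<lambda>n. poly (P n)) f sequentially"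
  shows "f \<in> LP_plus"
  using assms uniform_limit_compactI[of "\<lambda>n. poly (P n)" f] unfolding LP_plus_def by blast

lemma LP_plusE:
  assumes "f \<in> LP_plus"
  obtains P where "f holomorphic_on UNIV" and "\<And>n. negative_real_rooted (P n)"
    and "\<And>R. uniform_limit (cball 0 R) (\<lambda>n. poly (P n)) f sequentially"
  using assms compact_cball unfolding LP_plus_def by blast

text \<open>A diagonal choice: one polynomial per \<open>F n\<close>, within
  \<open>1 / (n + 1)\<close> of it on the disc of radius \<open>n\<close>. These discs eventually
  contain any given one.\<close>

lemma LP_plus_limit:
  assumes "f holomorphic_on UNIV" and F: "\<And>n. F n \<in> LP_plus"
    and lim: "\<And>R. R > 0 \<Longrightarrow> uniform_limit (cball 0 R) F f sequentially"
  shows "f \<in> LP_plus"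
proof -
  have "\<exists>p. negative_real_rooted p \<and> (\<forall>z\<in>cball 0 (real n). dist (poly p z) (F n z) < 1 / real (Suc n))" for n
  proof -
    obtain P where P: "\<And>n. negative_real_rooted (P n)"
      and lim: "\<And>R. uniform_limit (cball 0 R) (\<lambda>n. poly (P n)) (F n) sequentially"
      using LP_plusE[OF F[of n]] by metis
    from lim[of "real n"] have "\<forall>\<^sub>F m in sequentially. \<forall>z\<in>cball 0 (real n). dist (poly (P m) z) (F n z) < 1 / real (Suc n)"
      by (rule uniform_limitD) simp
    then show ?thesis using P by (auto simp: eventually_sequentially)
  qed
  then obtain p where p: "\<And>n. negative_real_rooted (p n)"
    and close: "\<And>n z. z \<in> cball 0 (real n) \<Longrightarrow> dist (poly (p n) z) (F n z) < 1 / real (Suc n)"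
    by metis
  show ?thesis
  proof (rule LP_plusI[where P = p])
    fix R :: real assume "R > 0"
    show "uniform_limit (cball 0 R) (\<lambda>n. poly (p n)) f sequentially"
    proof (rule uniform_limitI)
      fix e :: real assume "e > 0"
      have "\<forall>\<^sub>F n in sequentially. \<forall>z\<in>cball 0 R. dist (F n z) (f z) < e / 2"
        using uniform_limitD[OF lim[OF \<open>R > 0\<close>], of "e / 2"] \<open>e > 0\<close> by simp
      moreover have "\<forall>\<^sub>F n in sequentially. R \<le> real n"
        using eventually_ge_at_top[of "nat \<lceil>R\<rceil>"] by eventually_elim linarith
      moreover have "\<forall>\<^sub>F n in sequentially. 1 / real (Suc n) < e / 2"
        using LIMSEQ_inverse_real_of_nat \<open>e > 0\<close>
        by (intro order_tendstoD(2)[where y = 0]) (auto simp: inverse_eq_divide)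
      ultimately show "\<forall>\<^sub>F n in sequentially. \<forall>z\<in>cball 0 R. dist (poly (p n) z) (f z) < e"
      proof eventually_elim
        case (elim n)
        show ?case
        proof
          fix z :: complex assume "z \<in> cball 0 R"
          then have "dist (poly (p n) z) (F n z) < 1 / real (Suc n)" "dist (F n z) (f z) < e / 2"
            using elim close[of z n] by auto
          then show "dist (poly (p n) z) (f z) < e"
            using elim(3) dist_triangle[of "poly (p n) z" "f z" "F n z"] by linarith
        qed
      qed
    qed
  qed (use assms p in auto)
qed

lemma LP_plus_cmult:
  assumes "f \<in> LP_plus"
  shows "(\<lambda>z. c * f z) \<in> LP_plus"
proof -
  obtain P where P: "f holomorphic_on UNIV" "\<And>n. negative_real_rooted (P n)"
    and lim: "\<And>R. uniform_limit (cball 0 R) (\<lambda>n. poly (P n)) f sequentially"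
    using LP_plusE[OF assms] by blast
  show ?thesis
  proof (rule LP_plusI[where P = "\<lambda>n. smult c (P n)"])
    show "negative_real_rooted (smult c (P n))" for n
      using P(2)[of n] by (auto simp: negative_real_rooted_def)
    show "uniform_limit (cball 0 R) (\<lambda>n. poly (smult c (P n))) (\<lambda>z. c * f z) sequentially" for R
      using bounded_linear.uniform_limit[OF bounded_linear_mult_right[of c] lim[of R]]
      by (simp only: flip: poly_smult)
  qed (use P in \<open>auto intro!: holomorphic_intros\<close>)
qed

lemma LP_plus_dilate:
  assumes "f \<in> LP_plus" and "c > 0"
  shows "(\<lambda>z. f (of_real c * z)) \<in> LP_plus"
proof -
  obtain P where P: "f holomorphic_on UNIV" "\<And>n. negative_real_rooted (P n)"
    and lim: "\<And>R. uniform_limit (cball 0 R) (\<lambda>n. poly (P n)) f sequentially"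
    using LP_plusE[OF assms(1)] by blast
  show ?thesis
  proof (rule LP_plusI[where P = "\<lambda>n. pcompose (P n) [:0, of_real c:]"])
    show "negative_real_rooted (pcompose (P n) [:0, of_real c:])" for n
      using P(2)[of n] \<open>c > 0\<close>
      by (force simp: negative_real_rooted_def poly_pcompose complex_nonpos_Reals_iff mult_le_0_iff)
    fix R :: real
    have "uniform_limit (cball 0 R) (\<lambda>n z. poly (P n) (of_real c * z)) (\<lambda>z. f (of_real c * z)) sequentially"
      by (rule uniform_limit_compose'[OF lim[of "c * R"]])
         (use \<open>c > 0\<close> in \<open>auto simp: norm_mult\<close>)
    moreover have "poly (pcompose (P n) [:0, of_real c:]) = (\<lambda>z. poly (P n) (of_real c * z))" for n
      by (simp add: poly_pcompose fun_eq_iff mult.commute)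
    ultimately show "uniform_limit (cball 0 R) (\<lambda>n. poly (pcompose (P n) [:0, of_real c:])) (\<lambda>z. f (of_real c * z)) sequentially"
      by simp
  qed (use P in \<open>auto intro!: holomorphic_on_compose_gen[OF _ P(1), unfolded o_def] holomorphic_intros\<close>)
qed

section \<open>The operator f -> \<beta> f + z f'\<close>

lemma uniform_limit_deriv:
  fixes f :: "complex \<Rightarrow> complex"
  assumes F: "\<And>n. F n holomorphic_on UNIV" and f: "f holomorphic_on UNIV"
    and lim: "uniform_limit (cball 0 (R + 1)) F f sequentially"
  shows "uniform_limit (cball 0 R) (\<lambda>n. deriv (F n)) (deriv f) sequentially"
proof (rule uniform_limitI)
  fix e :: real assume "e > 0"
  then have "e / 2 > 0" by simp
  from uniform_limitD[OF lim this]
  show "\<forall>\<^sub>F n in sequentially. \<forall>z\<in>cball 0 R. dist (deriv (F n) z) (deriv f z) < e"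
  proof eventually_elim
    case (elim n)
    show ?case
    proof
      fix z :: complex assume z: "z \<in> cball 0 R"
      have [simp]: "(F n) field_differentiable at z" "f field_differentiable at z"
        using F f holomorphic_on_imp_differentiable_at by blast+
      have hol: "(\<lambda>w. F n w - f w) holomorphic_on A" for A
        by (intro holomorphic_on_subset[OF holomorphic_on_diff[OF F f]]) auto
      have "norm ((deriv ^^ 1) (\<lambda>w. F n w - f w) z) \<le> fact 1 * (e / 2) / 1 ^ 1"
      proof (rule Cauchy_inequality[OF hol])
        show "continuous_on (cball z 1) (\<lambda>w. F n w - f w)"
          using hol holomorphic_on_imp_continuous_on by blast
        fix x assume "norm (z - x) = 1"
        then have "x \<in> cball 0 (R + 1)"
          using z norm_triangle_ineq4[of z "z - x"] by auto
        then show "norm (F n x - f x) \<le> e / 2"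
          using elim by (force simp: dist_norm)
      qed auto
      then show "dist (deriv (F n) z) (deriv f z) < e"
        using \<open>e > 0\<close> by (simp add: dist_norm)
    qed
  qed
qed

lemma Im_div_add_pos_nonneg:
  assumes "Im z > 0" and "\<rho> \<ge> 0"
  shows "Im (z / (z + of_real \<rho>)) \<ge> 0" and "Im (z / (z + of_real \<rho>)) = 0 \<longleftrightarrow> \<rho> = 0"
proof -
  have eq: "Im (z / (z + of_real \<rho>)) = \<rho> * Im z / ((Re z + \<rho>)\<^sup>2 + (Im z)\<^sup>2)"
    by (simp add: Im_divide algebra_simps)
  have "(Re z + \<rho>)\<^sup>2 + (Im z)\<^sup>2 > 0"
    using assms by (intro add_nonneg_pos) auto
  then show "Im (z / (z + of_real \<rho>)) \<ge> 0" "Im (z / (z + of_real \<rho>)) = 0 \<longleftrightarrow> \<rho> = 0"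
    using assms unfolding eq by (auto simp: less_imp_le)
qed

text \<open>The expression is \<beta> + z P'(z) / P(z) for a polynomial P with zeros
  \<open>- \<rho> i\<close>. If it vanished in the upper half-plane, all the nonnegative imaginary
  parts would vanish, so every \<open>\<rho> i\<close> would be 0 and the value would be
  \<open>\<beta> + n > 0\<close>. Conjugation settles the lower half-plane, and on the positive axis
  all terms are nonnegative.\<close>

lemma theta_logderiv_nonzero:
  fixes n :: nat and z :: complex
  assumes "z \<notin> \<real>\<^sub>\<le>\<^sub>0" and "\<beta> > 0" and \<rho>: "\<And>i. i < n \<Longrightarrow> \<rho> i \<ge> 0"
  shows "of_real \<beta> + (\<Sum>i<n. z / (z + of_real (\<rho> i))) \<noteq> 0"
proof -
  have upper: "of_real \<beta> + (\<Sum>i<n. z / (z + of_real (\<rho> i))) \<noteq> 0" if z: "Im z > 0" for z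
  proof
    assume eq: "of_real \<beta> + (\<Sum>i<n. z / (z + of_real (\<rho> i))) = 0"
    have "(\<Sum>i<n. Im (z / (z + of_real (\<rho> i)))) = Im (of_real \<beta> + (\<Sum>i<n. z / (z + of_real (\<rho> i))))"
      by simp
    also have "\<dots> = 0" by (simp only: eq zero_complex.sel)
    finally have "\<forall>i<n. Im (z / (z + of_real (\<rho> i))) = 0"
      using Im_div_add_pos_nonneg(1)[OF z \<rho>] sum_nonneg_eq_0_iff[of "{..<n}" "\<lambda>i. Im (z / (z + of_real (\<rho> i)))"]
      by simp
    then have "\<forall>i<n. \<rho> i = 0"
      using Im_div_add_pos_nonneg(2)[OF z \<rho>] by blast
    then have "(\<Sum>i<n. z / (z + of_real (\<rho> i))) = (\<Sum>i<n. 1)"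
      using z by (intro sum.cong) auto
    then have "of_real (\<beta> + real n) = (0 :: complex)"
      using eq by simp
    then show False
      using \<open>\<beta> > 0\<close> by (simp only: of_real_eq_0_iff)
  qed
  consider "Im z > 0" | "Im z < 0" | "Im z = 0" "Re z > 0"
    using assms(1) by (force simp: complex_nonpos_Reals_iff)
  then show ?thesis
  proof cases
    case 2
    have "cnj (of_real \<beta> + (\<Sum>i<n. z / (z + of_real (\<rho> i)))) = of_real \<beta> + (\<Sum>i<n. cnj z / (cnj z + of_real (\<rho> i)))"
      by simp
    also have "\<dots> \<noteq> 0" using 2 by (intro upper) simp
    finally show ?thesis by force
  next
    case 3
    then have z: "z = of_real (Re z)" by (simp add: complex_eq_iff)
    have "of_real \<beta> + (\<Sum>i<n. z / (z + of_real (\<rho> i))) = of_real (\<beta> + (\<Sum>i<n. Re z / (Re z + \<rho> i)))"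
      by (subst (1 2) z) simp
    moreover have "\<beta> + (\<Sum>i<n. Re z / (Re z + \<rho> i)) > 0"
      using 3 \<open>\<beta> > 0\<close> \<rho> by (intro add_pos_nonneg sum_nonneg) (auto intro!: divide_nonneg_nonneg add_nonneg_nonneg)
    ultimately show ?thesis by (metis of_real_eq_0_iff less_irrefl)
  qed (use upper in blast)
qed

lemma negative_real_rooted_theta:
  assumes "negative_real_rooted P" and "\<beta> > 0"
  shows "negative_real_rooted (smult (of_real \<beta>) P + pCons 0 (pderiv P))"
proof (cases "P = 0")
  case False
  define n where "n = degree P"
  obtain r where r: "smult (lead_coeff P) (\<Prod>i<n. [:- r i, 1:]) = P"
    using complex_poly_decompose' n_def by metis
  have root: "poly P (r i) = 0" if "i < n" for i
    by (subst r[symmetric]) (use that in \<open>auto simp: poly_prod\<close>)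
  define \<rho> where "\<rho> i = - Re (r i)" for i
  have \<rho>: "r i = - of_real (\<rho> i)" "\<rho> i \<ge> 0" if "i < n" for i
    using root[OF that] assms(1) False
    by (auto simp: negative_real_rooted_def \<rho>_def complex_nonpos_Reals_iff complex_eq_iff)
  have P: "P = smult (lead_coeff P) (\<Prod>i<n. [:of_real (\<rho> i), 1:])"
    using \<rho>(1) by (subst r[symmetric]) simp
  show ?thesis
    unfolding negative_real_rooted_def
  proof (intro disjI2 allI impI)
    fix z assume z: "poly (smult (of_real \<beta>) P + pCons 0 (pderiv P)) z = 0"
    show "z \<in> \<real>\<^sub>\<le>\<^sub>0"
    proof (rule ccontr)
      assume neg: "z \<notin> \<real>\<^sub>\<le>\<^sub>0"
      have nz: "z + of_real (\<rho> i) \<noteq> 0" if "i < n" for i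
        using neg \<rho>(2)[OF that] by (auto simp: complex_nonpos_Reals_iff complex_eq_iff)
      \<comment> \<open>The logarithmic derivative, cleared of its denominator, by induction on the
        number of factors.\<close>
      have "z * poly (pderiv (\<Prod>i<m. [:of_real (\<rho> i), 1:])) z =
            poly (\<Prod>i<m. [:of_real (\<rho> i), 1:]) z * (\<Sum>i<m. z / (z + of_real (\<rho> i)))" if "m \<le> n" for m
        using that
      proof (induction m)
        case (Suc m)
        define Q where "Q = (\<Prod>i<m. [:of_real (\<rho> i), 1 :: complex:])"
        define S where "S = (\<Sum>i<m. z / (z + of_real (\<rho> i)))"
        have IH: "z * poly (pderiv Q) z = poly Q z * S"
          using Suc unfolding Q_def S_def by simp
        have nz: "z + of_real (\<rho> m) \<noteq> 0" using nz[of m] Suc by simp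
        have "z * poly (pderiv (Q * [:of_real (\<rho> m), 1:])) z =
              (z + of_real (\<rho> m)) * (z * poly (pderiv Q) z) + z * poly Q z"
          by (simp only: pderiv_mult) (simp add: pderiv_pCons algebra_simps)
        also have "\<dots> = (poly Q z * (z + of_real (\<rho> m))) * (S + z / (z + of_real (\<rho> m)))"
          unfolding IH using nz by (simp add: field_simps)
        also have "poly Q z * (z + of_real (\<rho> m)) = poly (Q * [:of_real (\<rho> m), 1:]) z"
          by (simp add: algebra_simps)
        finally show ?case
          by (simp only: Q_def S_def prod.lessThan_Suc sum.lessThan_Suc)
      qed (simp add: pderiv_1)
      from this[of n] have "z * poly (pderiv P) z = poly P z * (\<Sum>i<n. z / (z + of_real (\<rho> i)))"
        by (subst (1 2) P) (simp add: pderiv_smult)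
      then have "poly P z * (of_real \<beta> + (\<Sum>i<n. z / (z + of_real (\<rho> i)))) = 0"
        using z by (simp add: algebra_simps)
      moreover have "poly P z \<noteq> 0"
        using assms(1) False neg by (auto simp: negative_real_rooted_def)
      ultimately show False
        using theta_logderiv_nonzero[OF neg \<open>\<beta> > 0\<close>, of n \<rho>] \<rho>(2) by simp
    qed
  qed
qed (simp add: negative_real_rooted_def)

lemma LP_plus_theta:
  assumes "f \<in> LP_plus" and "\<beta> > 0"
  shows "(\<lambda>z. of_real \<beta> * f z + z * deriv f z) \<in> LP_plus"
proof -
  obtain P where P: "f holomorphic_on UNIV" "\<And>n. negative_real_rooted (P n)"
    and lim: "\<And>R. uniform_limit (cball 0 R) (\<lambda>n. poly (P n)) f sequentially"
    using LP_plusE[OF assms(1)] by blast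
  show ?thesis
  proof (rule LP_plusI[where P = "\<lambda>n. smult (of_real \<beta>) (P n) + pCons 0 (pderiv (P n))"])
    fix R :: real
    have "bounded (deriv f ` cball 0 R)"
      by (intro compact_imp_bounded compact_continuous_image holomorphic_on_imp_continuous_on
          holomorphic_on_subset[OF holomorphic_deriv[OF P(1)]]) auto
    moreover have "uniform_limit (cball 0 R) (\<lambda>n. deriv (poly (P n))) (deriv f) sequentially"
      by (rule uniform_limit_deriv[OF _ P(1) lim]) (auto intro: holomorphic_intros)
    ultimately have "uniform_limit (cball 0 R) (\<lambda>n z. of_real \<beta> * poly (P n) z + z * deriv (poly (P n)) z)
            (\<lambda>z. of_real \<beta> * f z + z * deriv f z) sequentially"
      by (intro uniform_limit_add bounded_linear.uniform_limit[OF bounded_linear_mult_right] lim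
          uniform_lim_mult uniform_limit_const) auto
    moreover have "deriv (poly p) = poly (pderiv p)" for p :: "complex poly"
      by (rule ext) (rule DERIV_imp_deriv[OF poly_DERIV])
    moreover have "poly (smult (of_real \<beta>) (P n) + pCons 0 (pderiv (P n))) =
        (\<lambda>z. of_real \<beta> * poly (P n) z + z * poly (pderiv (P n)) z)" for n
      by (simp add: fun_eq_iff)
    ultimately show "uniform_limit (cball 0 R) (\<lambda>n. poly (smult (of_real \<beta>) (P n) + pCons 0 (pderiv (P n))))
            (\<lambda>z. of_real \<beta> * f z + z * deriv f z) sequentially"
      by simp
  qed (use P assms(2) in \<open>auto intro!: holomorphic_intros holomorphic_deriv negative_real_rooted_theta\<close>)
qed

section \<open>Power series with an entire majorant\<close>

lemma fps_conv_radius_eq_infinityI: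
  fixes f g :: "complex fps"
  assumes "fps_conv_radius g = \<infinity>" and "\<And>n. norm (fps_nth f n) \<le> norm (fps_nth g n)"
  shows "fps_conv_radius f = \<infinity>"
  unfolding fps_conv_radius_def
proof (rule conv_radius_inftyI'')
  fix z :: complex
  have "summable (\<lambda>n. norm (fps_nth g n * z ^ n))"
    using assms(1) by (intro norm_summable_fps) simp
  then show "summable (\<lambda>n. fps_nth f n * z ^ n)"
    by (rule summable_comparison_test[rotated])
       (use assms(2) in \<open>auto simp: norm_mult norm_power intro!: mult_right_mono\<close>)
qed

text \<open>On the disc the difference is at most the sum of the coefficient differences times
  \<open>R ^ n\<close>, and Tannery's theorem sends that sum to 0. The limits leading to
  \<open>exp\<close>, to division by a Pochhammer symbol and to the confluence of parameters are all
  obtained from coefficients in this way.\<close>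

lemma uniform_limit_eval_fps:
  fixes f g :: "complex fps" and u :: "nat \<Rightarrow> complex fps"
  assumes lim: "\<And>n. (\<lambda>N. fps_nth (u N) n) \<longlonglongrightarrow> fps_nth f n"
    and bound: "\<And>N n. norm (fps_nth (u N) n) \<le> norm (fps_nth g n)"
    and g: "fps_conv_radius g = \<infinity>"
  shows "uniform_limit (cball 0 R) (\<lambda>N. eval_fps (u N)) (eval_fps f) sequentially"
proof (cases "R \<ge> 0")
  case True
  have bound_f: "norm (fps_nth f n) \<le> norm (fps_nth g n)" for n
    by (rule LIMSEQ_le_const2[OF tendsto_norm[OF lim[of n]]]) (use bound in blast)
  have sg: "summable (\<lambda>n. norm (fps_nth g n) * R ^ n)"
    using norm_summable_fps[of "of_real R" g] True g by (simp add: norm_mult norm_power)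
  define D where "D N n = norm (fps_nth (u N) n - fps_nth f n) * R ^ n" for N n
  have D_bound: "norm (D N n) \<le> 2 * (norm (fps_nth g n) * R ^ n)" for N n
  proof -
    have "norm (fps_nth (u N) n - fps_nth f n) \<le> 2 * norm (fps_nth g n)"
      using norm_triangle_ineq4[of "fps_nth (u N) n" "fps_nth f n"] bound[of N n] bound_f[of n] by linarith
    then have "norm (fps_nth (u N) n - fps_nth f n) * R ^ n \<le> (2 * norm (fps_nth g n)) * R ^ n"
      by (rule mult_right_mono) (use True in simp)
    then show ?thesis using True by (simp add: D_def abs_mult)
  qed
  have sD: "summable (D N)" for N
    by (rule summable_comparison_test[OF _ summable_mult[OF sg, of 2]]) (use D_bound in auto)
  have "(\<lambda>N. suminf (D N)) \<longlonglongrightarrow> suminf (\<lambda>n. 0 :: real)"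
  proof (rule tannerys_theorem[where M = "\<lambda>n. 2 * (norm (fps_nth g n) * R ^ n)", THEN conjunct2, THEN conjunct2])
    show "(\<lambda>N. D N n) \<longlonglongrightarrow> 0" for n
      unfolding D_def using tendsto_mult_right[OF tendsto_norm[OF LIM_zero[OF lim[of n]]], of "R ^ n"] by simp
    show "summable (\<lambda>n. 2 * (norm (fps_nth g n) * R ^ n))"
      using sg by (rule summable_mult)
  qed (use D_bound in \<open>auto intro!: always_eventually\<close>)
  then have D0: "(\<lambda>N. suminf (D N)) \<longlonglongrightarrow> 0" by simp
  have le: "dist (eval_fps (u N) z) (eval_fps f z) \<le> suminf (D N)" if "z \<in> cball 0 R" for N z
  proof -
    have rad: "fps_conv_radius (u N) = \<infinity>" "fps_conv_radius f = \<infinity>"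
      using fps_conv_radius_eq_infinityI[OF g] bound bound_f by blast+
    have "(\<lambda>n. fps_nth (u N) n * z ^ n - fps_nth f n * z ^ n) sums (eval_fps (u N) z - eval_fps f z)"
      using rad by (intro sums_diff sums_eval_fps) auto
    then have eq: "eval_fps (u N) z - eval_fps f z = (\<Sum>n. (fps_nth (u N) n - fps_nth f n) * z ^ n)"
      by (simp add: sums_iff algebra_simps)
    have le_D: "norm ((fps_nth (u N) n - fps_nth f n) * z ^ n) \<le> D N n" for n
      unfolding D_def norm_mult norm_power using that by (intro mult_left_mono power_mono) auto
    show ?thesis
      unfolding dist_norm eq by (rule norm_suminf_le[OF le_D sD])
  qed
  show ?thesis
  proof (rule uniform_limitI)
    fix e :: real assume "e > 0"
    with D0 have "\<forall>\<^sub>F N in sequentially. suminf (D N) < e"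
      by (rule order_tendstoD)
    then show "\<forall>\<^sub>F N in sequentially. \<forall>z\<in>cball 0 R. dist (eval_fps (u N) z) (eval_fps f z) < e"
      by (rule eventually_mono) (blast intro: le_less_trans[OF le])
  qed
qed (simp add: uniform_limit_iff)

lemma eval_fps_dilate: "eval_fps (Abs_fps (\<lambda>n. fps_nth f n * c ^ n)) z = eval_fps f (c * z)"
  for f :: "complex fps"
  by (simp add: eval_fps_def power_mult_distrib mult.assoc)

text \<open>Euler's approximants \<open>(1 + z / (N + 1)) ^ (N + 1)\<close> have
  \<open>- (N + 1)\<close> as their only zero. The series of \<open>exp\<close> is itself the
  majorant, because \<open>(N + 1 choose k) * fact k \<le> (N + 1) ^ k\<close>.\<close>

lemma exp_in_LP_plus: "exp \<in> LP_plus"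
proof (rule LP_plusI[where P = "\<lambda>N. [:1, inverse (of_nat (Suc N)):] ^ Suc N"])
  show "negative_real_rooted ([:1, inverse (of_nat (Suc N)):] ^ Suc N)" for N
    unfolding negative_real_rooted_def
  proof (intro disjI2 allI impI)
    fix z :: complex assume "poly ([:1, inverse (of_nat (Suc N)):] ^ Suc N) z = 0"
    then have "1 + inverse (of_nat (Suc N)) * z = 0"
      by (simp only: poly_power power_eq_0_iff poly_pCons poly_0) (simp add: mult.commute)
    then have "z = - of_nat (Suc N)"
      by (simp add: field_simps add_eq_0_iff del: of_nat_Suc)
    then show "z \<in> \<real>\<^sub>\<le>\<^sub>0"
      by (simp add: complex_nonpos_Reals_iff)
  qed
  fix R :: real
  define u where "u N = Abs_fps (\<lambda>k. of_nat (Suc N choose k) / of_nat (Suc N) ^ k :: complex)" for N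
  have "uniform_limit (cball 0 R) (\<lambda>N. eval_fps (u N)) (eval_fps (fps_exp 1)) sequentially"
  proof (rule uniform_limit_eval_fps[where g = "fps_exp 1"])
    fix k
    have "(\<lambda>N. (\<Prod>i = 0..<k. 1 - of_nat i * inverse (of_nat (Suc N)))) \<longlonglongrightarrow>
             (\<Prod>i = 0..<k. 1 - of_nat i * (0 :: complex))"
      by (intro tendsto_prod tendsto_diff tendsto_mult tendsto_const
          filterlim_compose[OF lim_inverse_n filterlim_Suc])
    then have lim: "(\<lambda>N. (\<Prod>i = 0..<k. 1 - of_nat i * inverse (of_nat (Suc N))) / fact k) \<longlonglongrightarrow> (1 / fact k :: complex)"
      by (auto intro!: tendsto_divide)
    have "fps_nth (u N) k = (\<Prod>i = 0..<k. 1 - of_nat i * inverse (of_nat (Suc N))) / fact k" for N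
    proof -
      have "fps_nth (u N) k = ((\<Prod>i = 0..<k. of_nat (Suc N) - of_nat i) / (\<Prod>i = 0..<k. of_nat (Suc N))) / fact k"
        unfolding u_def by (simp add: binomial_gbinomial gbinomial_prod_rev del: of_nat_Suc)
      also have "\<dots> = (\<Prod>i = 0..<k. 1 - of_nat i * inverse (of_nat (Suc N))) / fact k"
        unfolding prod_dividef[symmetric] by (intro arg_cong2[where f = "(/)"] prod.cong) (auto simp: field_simps simp del: of_nat_Suc)
      finally show ?thesis .
    qed
    with lim show "(\<lambda>N. fps_nth (u N) k) \<longlonglongrightarrow> fps_nth (fps_exp 1) k"
      by simp
    show "norm (fps_nth (u N) k) \<le> norm (fps_nth (fps_exp 1 :: complex fps) k)" for N
    proof -
      have "real ((Suc N choose k) * fact k) \<le> real (Suc N ^ k)"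
        using binomial_fact_pow of_nat_le_iff by blast
      then show ?thesis
        unfolding u_def by (simp add: norm_divide norm_power field_simps del: of_nat_Suc)
    qed
  qed simp
  moreover have "eval_fps (u N) = poly ([:1, inverse (of_nat (Suc N)):] ^ Suc N)" for N
  proof
    fix z
    have "eval_fps (u N) z = (\<Sum>k\<le>Suc N. of_nat (Suc N choose k) / of_nat (Suc N) ^ k * z ^ k)"
      unfolding u_def eval_fps_def by (subst suminf_finite[of "{..Suc N}"]) (auto simp: binomial_eq_0)
    also have "\<dots> = (z / of_nat (Suc N) + 1) ^ Suc N"
      unfolding binomial_ring by (intro sum.cong) (auto simp: power_divide)
    finally show "eval_fps (u N) z = poly ([:1, inverse (of_nat (Suc N)):] ^ Suc N) z"
      by (simp only: poly_power poly_pCons poly_0) (simp only: divide_inverse add.commute mult_zero_right add_0)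
  qed
  moreover have "eval_fps (fps_exp 1) = (exp :: complex \<Rightarrow> complex)"
    by (simp add: fun_eq_iff)
  ultimately show "uniform_limit (cball 0 R) (\<lambda>N. poly ([:1, inverse (of_nat (Suc N)):] ^ Suc N)) (exp :: complex \<Rightarrow> complex) sequentially"
    by (simp del: power_Suc of_nat_Suc)
qed (auto intro: holomorphic_intros)

section \<open>Pochhammer symbols as coefficient multipliers\<close>

lemma eval_fps_theta:
  fixes f :: "complex fps"
  assumes "fps_conv_radius f = \<infinity>"
  shows "fps_conv_radius (Abs_fps (\<lambda>n. (\<beta> + of_nat n) * fps_nth f n)) = \<infinity>" (is ?rad)
    and "eval_fps (Abs_fps (\<lambda>n. (\<beta> + of_nat n) * fps_nth f n)) z = \<beta> * eval_fps f z + z * deriv (eval_fps f) z" (is ?eval)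
proof -
  have "Abs_fps (\<lambda>n. (\<beta> + of_nat n) * fps_nth f n) = fps_const \<beta> * f + fps_XD f"
    by (rule fps_ext) (simp add: distrib_right)
  then have eq: "Abs_fps (\<lambda>n. (\<beta> + of_nat n) * fps_nth f n) = fps_const \<beta> * f + fps_X * fps_deriv f"
    by (simp add: fps_XD_def)
  have r1: "fps_conv_radius (fps_const \<beta> * f) = \<infinity>" and r2: "fps_conv_radius (fps_deriv f) = \<infinity>"
    and r3: "fps_conv_radius (fps_X * fps_deriv f) = \<infinity>"
    using fps_conv_radius_mult[of "fps_const \<beta>" f] fps_conv_radius_deriv[of f]
      fps_conv_radius_mult[of fps_X "fps_deriv f"] assms by auto
  show ?rad
    unfolding eq using fps_conv_radius_add[of "fps_const \<beta> * f" "fps_X * fps_deriv f"] r1 r3 by simp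
  show ?eval
    unfolding eq using r1 r2 r3 assms by (simp add: eval_fps_add eval_fps_mult eval_fps_deriv)
qed

text \<open>Since \<open>X * pochhammer (X + 1) n = (X + n) * pochhammer X n\<close>, raising
  \<open>m\<close> by one applies f -> \<beta> f + z f' with \<open>\<beta> = c + m\<close> and
  divides by \<beta>. The convergence radius is carried through the induction because the operator
  acts on coefficients only for a convergent series.\<close>

lemma LP_plus_pochhammer_ratio:
  assumes "eval_fps f \<in> LP_plus" and f: "fps_conv_radius f = \<infinity>" and "c > 0"
  shows "fps_conv_radius (Abs_fps (\<lambda>n. pochhammer (of_real (c + real m)) n / pochhammer (of_real c) n * fps_nth f n)) = \<infinity> \<and>
         eval_fps (Abs_fps (\<lambda>n. pochhammer (of_real (c + real m)) n / pochhammer (of_real c) n * fps_nth f n)) \<in> LP_plus"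
proof (induction m)
  case 0
  have "pochhammer (complex_of_real c) n \<noteq> 0" for n
    using pochhammer_pos[OF \<open>c > 0\<close>, of n] by (simp add: pochhammer_of_real)
  then show ?case using assms by (simp add: fps_nth_inverse)
next
  case (Suc m)
  define g where "g = Abs_fps (\<lambda>n. pochhammer (of_real (c + real m)) n / pochhammer (of_real c) n * fps_nth f n)"
  have cm: "c + real m > 0" using \<open>c > 0\<close> by simp
  define X where "X = complex_of_real (c + real m)"
  have X: "X \<noteq> 0" using cm unfolding X_def of_real_eq_0_iff by simp
  have X1: "complex_of_real (c + real (Suc m)) = X + 1" by (simp add: X_def)
  have step: "pochhammer (X + 1) n = inverse X * ((X + of_nat n) * pochhammer X n)" for n
  proof -
    have "X * pochhammer (X + 1) n = pochhammer X (Suc n)"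
      by (rule pochhammer_rec[symmetric])
    also have "\<dots> = (X + of_nat n) * pochhammer X n"
      by (simp only: pochhammer_Suc mult.commute)
    finally have "inverse X * (X * pochhammer (X + 1) n) = inverse X * ((X + of_nat n) * pochhammer X n)"
      by (rule arg_cong)
    then show ?thesis unfolding mult.assoc[symmetric] using X by simp
  qed
  define h where "h = Abs_fps (\<lambda>n. (X + of_nat n) * fps_nth g n)"
  have g: "fps_conv_radius g = \<infinity>" "eval_fps g \<in> LP_plus"
    using Suc unfolding g_def by auto
  have "fps_conv_radius h = \<infinity>" "eval_fps h = (\<lambda>z. X * eval_fps g z + z * deriv (eval_fps g) z)"
    using eval_fps_theta[OF g(1), of X] unfolding h_def by auto
  then have h: "fps_conv_radius h = \<infinity>" "eval_fps h \<in> LP_plus"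
    using LP_plus_theta[OF g(2) cm] by (simp_all only: X_def)
  have eq: "Abs_fps (\<lambda>n. pochhammer (of_real (c + real (Suc m))) n / pochhammer (of_real c) n * fps_nth f n) =
      fps_const (inverse X) * h"
    by (rule fps_ext) (simp only: X1 step fps_nth_Abs_fps h_def g_def fps_mult_left_const_nth
        X_def[symmetric] times_divide_eq_left times_divide_eq_right mult.assoc)
  have "fps_conv_radius (fps_const (inverse X) * h) = \<infinity>"
    using fps_conv_radius_mult[of "fps_const (inverse X)" h] h(1) by simp
  moreover have "eval_fps (fps_const (inverse X) * h) = (\<lambda>z. inverse X * eval_fps h z)"
    using h(1) by (simp add: eval_fps_mult fun_eq_iff)
  ultimately show ?case
    unfolding eq using LP_plus_cmult[OF h(2), of "inverse X"] by simp
qed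

text \<open>A bound uniform in \<open>N\<close>: each factor
  \<open>(c + N + 1 + i) / (N + 1)\<close> is at most \<open>c + 1 + i\<close>, and
  \<open>pochhammer (c + 1) n / pochhammer c n\<close> telescopes to \<open>(c + n) / c\<close>.
  Being linear in \<open>n\<close>, the bound still yields an entire majorant.\<close>

lemma pochhammer_shift_bound:
  fixes c :: real
  assumes "c > 0"
  shows "pochhammer (c + real (Suc N)) n / pochhammer c n * inverse (real (Suc N)) ^ n \<le> (c + real n) / c"
proof -
  have pos: "pochhammer c n > 0"
    by (rule pochhammer_pos[OF assms])
  have "pochhammer (c + real (Suc N)) n * inverse (real (Suc N)) ^ n =
      (\<Prod>i = 0..<n. (c + real (Suc N) + real i) * inverse (real (Suc N)))"
    unfolding pochhammer_prod prod.distrib by simp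
  also have "\<dots> \<le> (\<Prod>i = 0..<n. c + 1 + real i)"
  proof (rule prod_mono)
    fix i :: nat
    have eq: "(c + real (Suc N) + real i) * inverse (real (Suc N)) = (c + i) * inverse (real (Suc N)) + 1"
      by (simp add: field_simps)
    have "(c + i) * inverse (real (Suc N)) \<le> c + i"
      using assms by (intro mult_left_le) (auto simp: field_simps)
    moreover have "0 \<le> (c + i) * inverse (real (Suc N))"
      using assms by (intro mult_nonneg_nonneg) auto
    ultimately show "0 \<le> (c + real (Suc N) + real i) * inverse (real (Suc N)) \<and>
        (c + real (Suc N) + real i) * inverse (real (Suc N)) \<le> c + 1 + real i"
      unfolding eq by simp
  qed
  also have "\<dots> = pochhammer (c + 1) n"
    by (simp only: pochhammer_prod)
  finally have le: "pochhammer (c + real (Suc N)) n * inverse (real (Suc N)) ^ n / pochhammer c n \<le> pochhammer (c + 1) n / pochhammer c n"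
    by (rule divide_right_mono) (use pos in simp)
  have "c * pochhammer (c + 1) n = (c + real n) * pochhammer c n"
    using pochhammer_rec[of c n] pochhammer_Suc[of c n] by (simp only: mult.commute)
  then have "pochhammer (c + 1) n / pochhammer c n = (c + real n) / c"
    using pos assms by (simp add: field_simps)
  with le show ?thesis by (simp only: times_divide_eq_left)
qed

text \<open>Since \<open>1 / (c)\<^sub>n\<close> is the limit of \<open>(c + N)\<^sub>n / (c)\<^sub>n * N ^ -n\<close>, the function is
  a limit of dilations of the functions in \<open>LP_plus_pochhammer_ratio\<close>.\<close>
lemma LP_plus_divide_pochhammer:
  assumes "eval_fps f \<in> LP_plus" and f: "fps_conv_radius f = \<infinity>" and "c > 0"
  shows "fps_conv_radius (Abs_fps (\<lambda>n. fps_nth f n / pochhammer (of_real c) n)) = \<infinity> \<and>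
         eval_fps (Abs_fps (\<lambda>n. fps_nth f n / pochhammer (of_real c) n)) \<in> LP_plus"
proof -
  \<comment> \<open>Divided by \<open>c\<close>, this is the majorant supplied by
    \<open>pochhammer_shift_bound\<close>.\<close>
  define g where "g = Abs_fps (\<lambda>n. (of_real c + of_nat n) * fps_nth f n)"
  have "fps_conv_radius g = \<infinity>"
    unfolding g_def by (rule eval_fps_theta(1)[OF f])
  then have rad: "fps_conv_radius (fps_const (inverse (of_real c)) * g) = \<infinity>"
    using fps_conv_radius_mult[of "fps_const (inverse (of_real c))" g] by simp
  \<comment> \<open>\<open>Suc N\<close> makes the dilation factor positive already for
    \<open>N = 0\<close>.\<close>
  define u where "u N = Abs_fps (\<lambda>n. pochhammer (of_real (c + real (Suc N))) n / pochhammer (of_real c) n *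
    fps_nth f n * inverse (of_nat (Suc N)) ^ n)" for N
  define h where "h = Abs_fps (\<lambda>n. fps_nth f n / pochhammer (of_real c) n)"
  have poch_pos: "pochhammer c n > 0" for n
    by (rule pochhammer_pos[OF \<open>c > 0\<close>])
  have bound: "norm (fps_nth (u N) n) \<le> norm (fps_nth (fps_const (inverse (of_real c)) * g) n)" for N n
  proof -
    define t where "t = pochhammer (c + real (Suc N)) n / pochhammer c n * inverse (real (Suc N)) ^ n"
    have t: "0 \<le> t" "t \<le> (c + real n) / c"
      using pochhammer_shift_bound[OF \<open>c > 0\<close>, of N n] pochhammer_pos[of "c + real (Suc N)" n] poch_pos[of n] \<open>c > 0\<close>
      unfolding t_def by (auto intro!: mult_nonneg_nonneg divide_nonneg_nonneg)
    have u: "fps_nth (u N) n = of_real t * fps_nth f n"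
      unfolding u_def t_def fps_nth_Abs_fps pochhammer_of_real of_real_mult of_real_divide of_real_power
        of_real_inverse of_real_of_nat_eq by (simp only: mult_ac)
    have g: "fps_nth (fps_const (inverse (of_real c)) * g) n = of_real ((c + real n) / c) * fps_nth f n"
      by (simp add: g_def divide_inverse)
    have "norm (fps_nth (u N) n) = t * norm (fps_nth f n)"
      unfolding u norm_mult norm_of_real using t by simp
    also have "\<dots> \<le> (c + real n) / c * norm (fps_nth f n)"
      using t by (intro mult_right_mono) auto
    also have "\<dots> = norm (fps_nth (fps_const (inverse (of_real c)) * g) n)"
      unfolding g norm_mult norm_of_real using \<open>c > 0\<close> by simp
    finally show ?thesis .
  qed
  have lim: "(\<lambda>N. fps_nth (u N) n) \<longlonglongrightarrow> fps_nth h n" for n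
  proof -
    have "(\<lambda>N. \<Prod>i = 0..<n. 1 + (of_real c + of_nat i) * inverse (of_nat (Suc N))) \<longlonglongrightarrow>
             (\<Prod>i = 0..<n. 1 + (of_real c + of_nat i) * (0 :: complex))"
      by (intro tendsto_prod tendsto_add tendsto_mult tendsto_const
          filterlim_compose[OF lim_inverse_n filterlim_Suc])
    then have lim: "(\<lambda>N. (\<Prod>i = 0..<n. 1 + (of_real c + of_nat i) * inverse (of_nat (Suc N))) * fps_nth h n)
        \<longlonglongrightarrow> 1 * fps_nth h n"
      by (intro tendsto_mult tendsto_const) (simp only: mult_zero_right add_0_right prod.neutral_const tendsto_const)
    have "fps_nth (u N) n = (\<Prod>i = 0..<n. 1 + (of_real c + of_nat i) * inverse (of_nat (Suc N))) * fps_nth h n" for N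
    proof -
      have "(\<Prod>i = 0..<n. 1 + (complex_of_real c + of_nat i) * inverse (of_nat (Suc N)))
          = (\<Prod>i = 0..<n. (of_real (c + real (Suc N)) + of_nat i) * inverse (of_nat (Suc N)))"
        by (intro prod.cong) (auto simp: field_simps simp del: of_nat_Suc)
      then show ?thesis
        unfolding u_def h_def by (simp add: prod.distrib pochhammer_prod del: of_nat_Suc)
    qed
    with lim show ?thesis by simp
  qed
  have unif: "uniform_limit (cball 0 R) (\<lambda>N. eval_fps (u N)) (eval_fps h) sequentially" for R
    by (rule uniform_limit_eval_fps[OF lim bound rad])
  have h: "fps_conv_radius h = \<infinity>"
    by (rule fps_conv_radius_eq_infinityI[OF rad])
      (rule LIMSEQ_le_const2[OF tendsto_norm[OF lim]], use bound in blast)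
  have in_LP: "eval_fps (u N) \<in> LP_plus" for N
  proof -
    define v where "v = Abs_fps (\<lambda>n. pochhammer (of_real (c + real (Suc N))) n / pochhammer (of_real c) n * fps_nth f n)"
    have "eval_fps v \<in> LP_plus"
      using LP_plus_pochhammer_ratio[OF assms, of "Suc N"] unfolding v_def by blast
    then have "(\<lambda>z. eval_fps v (of_real (inverse (real (Suc N))) * z)) \<in> LP_plus"
      by (rule LP_plus_dilate) simp
    moreover have "(\<lambda>z. eval_fps v (of_real (inverse (real (Suc N))) * z)) = eval_fps (u N)"
      unfolding eval_fps_dilate[symmetric] u_def v_def by (simp add: fun_eq_iff del: of_nat_Suc)
    ultimately show ?thesis by simp
  qed
  have "eval_fps h holomorphic_on UNIV"
    by (rule holomorphic_on_eval_fps) (simp add: h)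
  then have "eval_fps h \<in> LP_plus"
    by (rule LP_plus_limit[OF _ in_LP unif])
  with h show ?thesis by (simp add: h_def)
qed

section \<open>Entire functions of exponential type with real zeros\<close>

text \<open>The Moebius map w -> w / (2 A - w) takes the half-plane \<open>Re w < A\<close> into the
  unit disc and fixes 0, so Schwarz' lemma applies after scaling by \<open>R\<close>. At
  \<open>norm z \<le> R / 2\<close> it gives
  \<open>norm (L z) \<le> A + norm (L z) / 2\<close>.\<close>

lemma Borel_Caratheodory:
  fixes A R :: real
  assumes L: "L holomorphic_on ball 0 R" "L 0 = 0" and Re: "\<And>z. norm z < R \<Longrightarrow> Re (L z) < A"
    and "R > 0" and z: "norm z \<le> R / 2"
  shows "norm (L z) \<le> 2 * A"
proof -
  have "A > 0" using Re[of 0] L(2) \<open>R > 0\<close> by simp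
  define \<phi> where "\<phi> w = L (of_real R * w) / (2 * of_real A - L (of_real R * w))" for w
  have R: "norm (of_real R * w) < R" if "norm w < 1" for w :: complex
    using that \<open>R > 0\<close> by (simp add: norm_mult)
  have nz: "2 * of_real A - L (of_real R * w) \<noteq> 0" if "norm w < 1" for w
  proof
    assume "2 * of_real A - L (of_real R * w) = 0"
    then have "Re (L (of_real R * w)) = 2 * A" by (simp add: complex_eq_iff)
    with Re[OF R[OF that]] \<open>A > 0\<close> show False by simp
  qed
  have "norm (\<phi> (z / of_real R)) \<le> norm (z / of_real R)"
  proof (rule Schwarz_Lemma)
    have "(\<lambda>w. L (of_real R * w)) holomorphic_on ball 0 1"
      by (rule holomorphic_on_compose_gen[OF _ L(1), unfolded o_def])
        (use R in \<open>auto intro!: holomorphic_intros\<close>)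
    then show "\<phi> holomorphic_on ball 0 1"
      unfolding \<phi>_def using nz by (intro holomorphic_intros) auto
    show "norm (\<phi> w) < 1" if "norm w < 1" for w
    proof -
      have "(norm (L (of_real R * w)))\<^sup>2 < (norm (2 * of_real A - L (of_real R * w)))\<^sup>2"
        using Re[OF R[OF that]] \<open>A > 0\<close> unfolding cmod_power2
        by (simp add: power2_eq_square algebra_simps)
      then have "norm (L (of_real R * w)) < norm (2 * of_real A - L (of_real R * w))"
        by (rule power2_less_imp_less) simp
      then show ?thesis
        unfolding \<phi>_def norm_divide using nz[OF that] by (simp add: divide_simps)
    qed
    show "norm (z / of_real R) < 1"
      using z \<open>R > 0\<close> by (simp add: norm_divide)
  qed (use L(2) in \<open>simp add: \<phi>_def\<close>)
  also have "\<dots> \<le> 1 / 2"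
    using z \<open>R > 0\<close> by (simp add: norm_divide field_simps)
  finally have "norm (L z) \<le> 1 / 2 * norm (2 * of_real A - L z)"
    using nz[of "z / of_real R"] z \<open>R > 0\<close> unfolding \<phi>_def norm_divide
    by (simp add: norm_divide field_simps)
  also have "\<dots> \<le> 1 / 2 * (2 * A + norm (L z))"
    using norm_triangle_ineq4[of "2 * of_real A" "L z"] \<open>A > 0\<close> by (simp add: norm_mult)
  finally show ?thesis by simp
qed

text \<open>Evenness kills the linear Taylor term, so only the second-order remainder is left.
  Circles of radius \<open>r / 4\<close> about points of the half-size disc stay inside
  \<open>ball 0 r\<close>, and Cauchy's inequality on them bounds the second derivative by
  \<open>2 * M / (r / 4)^2\<close>, whence the 32.\<close>

lemma even_holomorphic_bound:
  fixes r M :: real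
  assumes E: "E holomorphic_on ball 0 r" "E 0 = 0" and even: "\<And>z. norm z < r \<Longrightarrow> E (- z) = E z"
    and M: "\<And>z. norm z < r \<Longrightarrow> norm (E z) \<le> M" and "r > 0" and z: "norm z \<le> r / 2"
  shows "norm (E z) \<le> 32 * M / r\<^sup>2 * (norm z)\<^sup>2"
proof -
  have diff: "E field_differentiable at 0"
    using E(1) \<open>r > 0\<close> by (auto intro: holomorphic_on_imp_differentiable_at)
  have "((\<lambda>z. E (- z)) has_field_derivative - deriv E 0) (at 0)"
    using DERIV_chain2[where f = E and g = uminus and x = 0 and Da = "deriv E 0" and Db = "-1" and s = UNIV]
      diff by (simp add: field_differentiable_derivI DERIV_minus[OF DERIV_ident])
  moreover have "((\<lambda>z. E (- z)) has_field_derivative deriv E 0) (at 0)"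
    by (rule has_field_derivative_transform_within_open[where S = "ball 0 r" and f = E])
      (use diff even \<open>r > 0\<close> in \<open>auto simp: field_differentiable_derivI\<close>)
  ultimately have "deriv E 0 = 0"
    using DERIV_unique by fastforce
  have "norm ((deriv ^^ 0) E z - (\<Sum>i\<le>1. (deriv ^^ i) E 0 * (z - 0) ^ i / fact i))
      \<le> fact 2 * M / (r / 4) ^ 2 * norm (z - 0) ^ Suc 1 / fact 1"
  proof (rule complex_Taylor[where S = "cball 0 (r / 2)"])
    fix i and x :: complex assume x: "x \<in> cball 0 (r / 2)"
    then have "x \<in> ball 0 r" using \<open>r > 0\<close> by simp
    then show "((deriv ^^ i) E has_field_derivative (deriv ^^ Suc i) E x) (at x within cball 0 (r / 2))"
      using holomorphic_derivI[OF holomorphic_higher_deriv[OF E(1) open_ball, of i] open_ball] by simp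
  next
    fix x :: complex assume x: "x \<in> cball 0 (r / 2)"
    have sub: "cball x (r / 4) \<subseteq> ball 0 r"
    proof
      fix w assume "w \<in> cball x (r / 4)"
      then have "norm (w - x) \<le> r / 4" by (simp add: dist_norm norm_minus_commute)
      then have "norm w < r" using x norm_triangle_sub[of w x] \<open>r > 0\<close> by simp
      then show "w \<in> ball 0 r" by simp
    qed
    have "norm ((deriv ^^ 2) E x) \<le> fact 2 * M / (r / 4) ^ 2"
    proof (rule Cauchy_inequality)
      show "E holomorphic_on ball x (r / 4)"
        by (rule holomorphic_on_subset[OF E(1)]) (use sub ball_subset_cball in blast)
      show "continuous_on (cball x (r / 4)) E"
        by (rule holomorphic_on_imp_continuous_on[OF holomorphic_on_subset[OF E(1) sub]])
      show "norm (E w) \<le> M" if "norm (x - w) = r / 4" for w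
        using that sub by (intro M) (force simp: dist_norm)
    qed (use \<open>r > 0\<close> in simp)
    then show "norm ((deriv ^^ Suc 1) E x) \<le> fact 2 * M / (r / 4) ^ 2"
      by (simp add: numeral_2_eq_2)
  qed (use z \<open>r > 0\<close> in auto)
  then show ?thesis
    using \<open>deriv E 0 = 0\<close> E(2) by (simp add: power2_eq_square field_simps)
qed

text \<open>The factor is normalised to be 1 at the origin, so the cofactor keeps the value of
  \<open>g\<close> there. The singularity of the quotient is removable.\<close>

lemma holomorphic_factor_linear:
  assumes "g holomorphic_on UNIV" and "g x = 0" and "x \<noteq> 0"
  obtains h where "h holomorphic_on UNIV" and "\<And>z. g z = (1 - z / x) * h z"
proof
  let ?h = "\<lambda>z. if z = x then deriv g x else (g z - g x) / (z - x)"
  show "(\<lambda>z. - x * ?h z) holomorphic_on UNIV"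
    using pole_lemma[OF assms(1), of x] by (intro holomorphic_intros) simp
  show "g z = (1 - z / x) * (- x * ?h z)" for z
    using assms(2,3) by (simp add: field_simps)
qed

lemma norm_linear_factors_ge:
  assumes "\<And>x. x \<in> set xs \<Longrightarrow> x \<noteq> 0 \<and> \<bar>x\<bar> \<le> R" and "norm z = 3 * R"
  shows "2 ^ length xs \<le> norm (\<Prod>x\<leftarrow>xs. 1 - z / complex_of_real x)"
  using assms(1)
proof (induction xs)
  case (Cons x xs)
  then have x: "x \<noteq> 0" "\<bar>x\<bar> \<le> R" by auto
  then have "3 \<le> norm (z / of_real x)"
    using assms(2) by (simp add: norm_divide field_simps)
  then have "2 \<le> norm (1 - z / complex_of_real x)"
    using norm_triangle_ineq2[of "z / of_real x" 1] by (simp add: norm_minus_commute)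
  moreover have "2 ^ length xs \<le> norm (\<Prod>x\<leftarrow>xs. 1 - z / complex_of_real x)"
    using Cons by simp
  ultimately show ?case
    by (simp add: norm_mult mult_mono)
qed simp

text \<open>An elementary substitute for Jensen's formula. On the circle of radius
  \<open>3 * R\<close> every factor has modulus at least 3 - 1 = 2, and the maximum principle
  carries the estimate inside. At \<open>z = 0\<close> it limits the number of zeros; elsewhere it
  controls the cofactor.\<close>

lemma linear_factors_quotient_bound:
  assumes f: "\<And>z. f z = (\<Prod>x\<leftarrow>xs. 1 - z / complex_of_real x) * g z" and g: "g holomorphic_on UNIV"
    and xs: "\<And>x. x \<in> set xs \<Longrightarrow> x \<noteq> 0 \<and> \<bar>x\<bar> \<le> R"
    and M: "\<And>z. norm z = 3 * R \<Longrightarrow> norm (f z) \<le> M" and z: "norm z \<le> 3 * R" and "R > 0"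
  shows "2 ^ length xs * norm (g z) \<le> M"
proof -
  have "norm (2 ^ length xs * g z) \<le> M"
  proof (rule maximum_modulus_frontier[where S = "cball 0 (3 * R)" and f = "\<lambda>z. 2 ^ length xs * g z"])
    show "(\<lambda>z. 2 ^ length xs * g z) holomorphic_on interior (cball 0 (3 * R))"
      using g by (intro holomorphic_intros) (auto intro: holomorphic_on_subset)
    show "continuous_on (closure (cball 0 (3 * R))) (\<lambda>z. 2 ^ length xs * g z)"
      using g by (intro continuous_intros holomorphic_on_imp_continuous_on) (auto intro: holomorphic_on_subset)
    fix w assume "w \<in> frontier (cball (0 :: complex) (3 * R))"
    then have w: "norm w = 3 * R" by simp
    have "norm (2 ^ length xs * g w) \<le> norm (\<Prod>x\<leftarrow>xs. 1 - w / complex_of_real x) * norm (g w)"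
      unfolding norm_mult using norm_linear_factors_ge[OF xs w] by (intro mult_right_mono) (auto simp: norm_power)
    also have "\<dots> = norm (f w)"
      by (simp add: f norm_mult)
    finally show "norm (2 ^ length xs * g w) \<le> M"
      using M[OF w] by simp
  qed (use z in auto)
  then show ?thesis by (simp add: norm_mult norm_power)
qed

text \<open>A factorization of maximal length has a cofactor without zeros in \<open>S\<close>,
  since a further zero could be split off. A list records multiplicities. The length bound is a
  hypothesis because it has two sources: for a disc the maximum principle, for the whole plane the
  growth on the imaginary axis.\<close>

lemma extract_real_zeros:
  assumes f: "f holomorphic_on UNIV" "f 0 = 1" "only_real_zeros f"
    and bdd: "\<And>xs g. \<lbrakk>\<And>z. f z = (\<Prod>x\<leftarrow>xs. 1 - z / complex_of_real x) * g z; g holomorphic_on UNIV;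
                 \<And>x. x \<in> set xs \<Longrightarrow> x \<noteq> 0 \<and> complex_of_real x \<in> S\<rbrakk> \<Longrightarrow> length xs \<le> (B :: nat)"
  obtains xs g where "\<And>z. f z = (\<Prod>x\<leftarrow>xs. 1 - z / complex_of_real x) * g z" "g holomorphic_on UNIV"
    "\<And>x. x \<in> set xs \<Longrightarrow> x \<noteq> 0 \<and> complex_of_real x \<in> S" "\<And>z. z \<in> S \<Longrightarrow> g z \<noteq> 0"
proof -
  define valid where "valid xs g \<longleftrightarrow> (\<forall>z. f z = (\<Prod>x\<leftarrow>xs. 1 - z / complex_of_real x) * g z) \<and>
    g holomorphic_on UNIV \<and> (\<forall>x\<in>set xs. x \<noteq> 0 \<and> complex_of_real x \<in> S)" for xs g
  define P where "P n \<longleftrightarrow> (\<exists>xs g. valid xs g \<and> length xs = n)" for n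
  have "P 0"
    unfolding P_def by (rule exI[of _ "[]"], rule exI[of _ f]) (use f in \<open>auto simp: valid_def\<close>)
  moreover have "n \<le> B" if "P n" for n
    using that bdd unfolding P_def valid_def by blast
  ultimately obtain n where "P n" and max: "\<And>m. P m \<Longrightarrow> m \<le> n"
    using GreatestI_nat[of P 0 B] Greatest_le_nat[of P _ B] by blast
  then obtain xs g where valid: "valid xs g" and n: "length xs = n"
    by (auto simp: P_def)
  have "g z \<noteq> 0" if "z \<in> S" for z
  proof
    assume "g z = 0"
    have "f 0 = (\<Prod>x\<leftarrow>xs. 1 - 0 / complex_of_real x) * g 0"
      using valid unfolding valid_def by blast
    then have "g 0 = 1" using f(2) by (simp add: map_replicate_const)
    with \<open>g z = 0\<close> have "z \<noteq> 0" by auto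
    have "f z = 0" using \<open>g z = 0\<close> valid by (simp add: valid_def)
    then obtain x where x: "z = of_real x"
      using f(3) by (auto simp: only_real_zeros_def elim: Reals_cases)
    obtain h where h: "h holomorphic_on UNIV" "\<And>w. g w = (1 - w / z) * h w"
      using holomorphic_factor_linear[of g z] valid \<open>g z = 0\<close> \<open>z \<noteq> 0\<close> by (auto simp: valid_def)
    have "f w = (\<Prod>x\<leftarrow>x # xs. 1 - w / complex_of_real x) * h w" for w
      using valid h(2)[of w] x by (simp add: valid_def mult_ac)
    then have "valid (x # xs) h"
      using valid h(1) x \<open>z \<noteq> 0\<close> \<open>z \<in> S\<close> by (simp add: valid_def)
    then have "P (Suc n)" unfolding P_def using n by (metis length_Cons)
    with max show False by fastforce
  qed
  then show thesis using that valid unfolding valid_def by blast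
qed

lemma extract_real_zeros_cball:
  assumes f: "f holomorphic_on UNIV" "f 0 = 1" "only_real_zeros f" and "R > 0"
  obtains xs g where "\<And>z. f z = (\<Prod>x\<leftarrow>xs. 1 - z / complex_of_real x) * g z" "g holomorphic_on UNIV"
    "\<And>x. x \<in> set xs \<Longrightarrow> x \<noteq> 0 \<and> \<bar>x\<bar> \<le> R" "\<And>z. norm z \<le> R \<Longrightarrow> g z \<noteq> 0"
proof -
  have "bounded (f ` cball 0 (3 * R))"
    using f(1) by (intro compact_imp_bounded compact_continuous_image)
      (auto intro!: holomorphic_on_imp_continuous_on intro: holomorphic_on_subset)
  then obtain M where "\<forall>w\<in>f ` cball 0 (3 * R). norm w \<le> M"
    unfolding bounded_iff by blast
  then have M: "norm (f z) \<le> M" if "norm z \<le> 3 * R" for z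
    using that by simp
  show thesis
  proof (rule extract_real_zeros[OF f, of "cball 0 R" "nat \<lceil>M\<rceil>"])
    fix xs g
    assume *: "\<And>z. f z = (\<Prod>x\<leftarrow>xs. 1 - z / complex_of_real x) * g z" "g holomorphic_on UNIV"
      "\<And>x. x \<in> set xs \<Longrightarrow> x \<noteq> 0 \<and> complex_of_real x \<in> cball 0 R"
    have "g 0 = 1" using *(1)[of 0] f(2) by (simp add: map_replicate_const)
    have "2 ^ length xs * norm (g 0) \<le> M"
      by (rule linear_factors_quotient_bound[OF *(1,2)]) (use *(3) M \<open>R > 0\<close> in auto)
    then have "2 ^ length xs \<le> M" using \<open>g 0 = 1\<close> by simp
    moreover have "real (length xs) < 2 ^ length xs" by (rule of_nat_less_two_power)
    ultimately show "length xs \<le> nat \<lceil>M\<rceil>" by linarith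
  qed (use that in auto)
qed

text \<open>Let \<open>h\<close> be the cofactor of all zeros in the disc of radius \<open>R\<close>. The function
  \<open>h z * h (- z) = exp (E z)\<close> has an even exponent of size \<open>O(R)\<close> on a disc of radius
  comparable to \<open>R\<close>, hence \<open>E z = O(\<bar>z\<bar>\<^sup>2 / R)\<close>, which disappears as \<open>R\<close> grows.\<close>
lemma imaginary_axis_lower_bound_radius:
  assumes f: "f holomorphic_on UNIV" "f 0 = 1" "only_real_zeros f"
    and growth: "\<And>z. norm (f z) \<le> C * exp (D * norm z)" and "D \<ge> 0"
    and g: "\<And>z. f z = (\<Prod>x\<leftarrow>xs. 1 - z / complex_of_real x) * g z" "g holomorphic_on UNIV"
    and xs: "\<And>x. x \<in> set xs \<Longrightarrow> x \<noteq> 0 \<and> \<bar>x\<bar> \<le> R" and "R > 0" and y: "\<bar>y\<bar> \<le> R / 4"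
  shows "(\<Prod>x\<leftarrow>xs. 1 + y\<^sup>2 / x\<^sup>2) * exp (- (512 * (\<bar>C\<bar> + 3 * D * R + 1) / R\<^sup>2 * y\<^sup>2))
      \<le> norm (f (\<i> * of_real y) * f (- (\<i> * of_real y)))"
proof -
  have g0: "g 0 = 1"
    using g(1)[of 0] f(2) by (simp add: map_replicate_const)
  have "only_real_zeros g"
    using f(3) g(1) unfolding only_real_zeros_def by simp
  then obtain ys h where h: "\<And>z. g z = (\<Prod>x\<leftarrow>ys. 1 - z / complex_of_real x) * h z" "h holomorphic_on UNIV"
    and ys: "\<And>x. x \<in> set ys \<Longrightarrow> x \<noteq> 0 \<and> \<bar>x\<bar> \<le> R" and nz: "\<And>z. norm z \<le> R \<Longrightarrow> h z \<noteq> 0"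
    using extract_real_zeros_cball[OF g(2) g0 _ \<open>R > 0\<close>] by metis
  have h0: "h 0 = 1"
    using h(1)[of 0] g0 by (simp add: map_replicate_const)
  have fh: "f z = (\<Prod>x\<leftarrow>xs @ ys. 1 - z / complex_of_real x) * h z" for z
    by (simp add: g(1)[of z] h(1)[of z])
  \<comment> \<open>The term \<open>3 * D * R\<close> comes from the circle of radius
    \<open>3 * R\<close>; the rest strictly exceeds \<open>ln C\<close>, as the strict bound on the
    real part in \<open>Borel_Caratheodory\<close> requires.\<close>
  define A where "A = \<bar>C\<bar> + 3 * D * R + 1"
  have C: "C \<ge> 1" using growth[of 0] f(2) by simp
  have A: "C * exp (3 * D * R) < exp A"
  proof -
    have "C < exp (C + 1)" using exp_ge_add_one_self[of "C + 1"] by linarith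
    then show ?thesis using C by (simp add: A_def exp_add mult_ac)
  qed
  have bound: "norm (h z) \<le> C * exp (3 * D * R)" if "norm z \<le> R" for z
  proof -
    have "2 ^ length (xs @ ys) * norm (h z) \<le> C * exp (3 * D * R)"
    proof (rule linear_factors_quotient_bound[OF fh h(2)])
      fix w :: complex assume "norm w = 3 * R"
      then show "norm (f w) \<le> C * exp (3 * D * R)"
        using growth[of w] by (simp add: mult_ac)
    qed (use xs ys that \<open>R > 0\<close> in auto)
    moreover have "1 * norm (h z) \<le> 2 ^ length (xs @ ys) * norm (h z)"
      by (intro mult_right_mono) auto
    ultimately show ?thesis by simp
  qed
  obtain L0 where L0: "L0 holomorphic_on ball 0 R" "\<And>z. z \<in> ball 0 R \<Longrightarrow> exp (L0 z) = h z"
    by (rule holomorphic_logarithm_exists[of "ball 0 R" h 0])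
      (use h(2) nz \<open>R > 0\<close> in \<open>auto intro: holomorphic_on_subset\<close>)
  define L where "L z = L0 z - L0 0" for z
  have L: "L holomorphic_on ball 0 R" "L 0 = 0"
    unfolding L_def using L0(1) by (auto intro!: holomorphic_intros)
  have exp_L: "exp (L z) = h z" if "norm z < R" for z
    using L0(2)[of z] L0(2)[of 0] that \<open>R > 0\<close> h0 by (simp add: L_def exp_diff)
  have "norm (L z) \<le> 2 * A" if "norm z \<le> R / 2" for z
  proof (rule Borel_Caratheodory[OF L _ \<open>R > 0\<close> that])
    fix z :: complex assume z: "norm z < R"
    have "exp (Re (L z)) = norm (h z)"
      using exp_L[OF z] by (metis norm_exp_eq_Re)
    also have "\<dots> < exp A" using bound[of z] A z by simp
    finally show "Re (L z) < A" by simp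
  qed
  note L_bound = this
  define E where "E z = L z + L (- z)" for z
  let ?z = "\<i> * complex_of_real y"
  \<comment> \<open>Both terms of \<open>E\<close> are at most \<open>2 * A\<close> on the disc of
    radius \<open>R / 2\<close>. With \<open>r = R / 2\<close> the constant becomes 32 * 4 * 4 =
    512, and \<open>\<bar>y\<bar> \<le> R / 4\<close> is \<open>norm ?z \<le> r / 2\<close>.\<close>
  have "norm (E ?z) \<le> 32 * (4 * A) / (R / 2)\<^sup>2 * (norm ?z)\<^sup>2"
  proof (rule even_holomorphic_bound)
    have "L holomorphic_on ball 0 (R / 2)"
      by (rule holomorphic_on_subset[OF L(1)]) (use \<open>R > 0\<close> in auto)
    moreover have "(\<lambda>z. L (- z)) holomorphic_on ball 0 (R / 2)"
      by (rule holomorphic_on_compose_gen[OF _ calculation, of uminus, unfolded o_def])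
        (auto intro!: holomorphic_intros)
    ultimately show "E holomorphic_on ball 0 (R / 2)"
      unfolding E_def by (intro holomorphic_intros)
    show "norm (E z) \<le> 4 * A" if "norm z < R / 2" for z
      using L_bound[of z] L_bound[of "- z"] norm_triangle_ineq[of "L z" "L (- z)"] that by (simp add: E_def)
  qed (use L(2) \<open>R > 0\<close> y in \<open>auto simp: E_def norm_mult\<close>)
  also have "\<dots> = 512 * A / R\<^sup>2 * y\<^sup>2"
    by (simp add: norm_mult field_simps power2_eq_square)
  finally have "- (512 * A / R\<^sup>2 * y\<^sup>2) \<le> Re (E ?z)"
    using abs_Re_le_cmod[of "E ?z"] by linarith
  then have "exp (- (512 * A / R\<^sup>2 * y\<^sup>2)) \<le> norm (exp (E ?z))"
    by simp
  also have "exp (E ?z) = h ?z * h (- ?z)"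
    using exp_L[of ?z] exp_L[of "- ?z"] y \<open>R > 0\<close> by (simp add: E_def exp_add norm_mult)
  finally have hh: "exp (- (512 * A / R\<^sup>2 * y\<^sup>2)) \<le> norm (h ?z * h (- ?z))" .
  have prod: "norm ((\<Prod>x\<leftarrow>zs. 1 - ?z / complex_of_real x) * (\<Prod>x\<leftarrow>zs. 1 - (- ?z) / complex_of_real x)) =
      (\<Prod>x\<leftarrow>zs. 1 + y\<^sup>2 / x\<^sup>2)" for zs
  proof (induction zs)
    case (Cons x zs)
    have "(1 - ?z / complex_of_real x) * (1 - (- ?z) / complex_of_real x) = of_real (1 + y\<^sup>2 / x\<^sup>2)"
      by (cases "x = 0") (simp_all add: field_simps power2_eq_square)
    then have "norm ((1 - ?z / complex_of_real x) * (1 - (- ?z) / complex_of_real x)) = 1 + y\<^sup>2 / x\<^sup>2"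
      by (simp only: norm_of_real) (simp add: abs_of_nonneg)
    with Cons show ?case
      by (simp add: norm_mult mult_ac)
  qed simp
  have ge1: "1 \<le> (\<Prod>x\<leftarrow>zs. 1 + y\<^sup>2 / x\<^sup>2)" for zs
    by (induction zs) (auto intro: mult_ge1_I)
  have "(\<Prod>x\<leftarrow>xs. 1 + y\<^sup>2 / x\<^sup>2) * exp (- (512 * A / R\<^sup>2 * y\<^sup>2)) \<le>
      ((\<Prod>x\<leftarrow>xs. 1 + y\<^sup>2 / x\<^sup>2) * (\<Prod>x\<leftarrow>ys. 1 + y\<^sup>2 / x\<^sup>2)) * norm (h ?z * h (- ?z))"
    using ge1[of xs] ge1[of ys] hh by (intro mult_mono) auto
  also have "\<dots> = norm (f ?z * f (- ?z))"
    unfolding prod[symmetric] fh[of ?z] fh[of "- ?z"] by (simp only: map_append prod_list.append norm_mult mult_ac)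
  finally show ?thesis unfolding A_def .
qed

text \<open>With \<open>y\<close> and \<open>xs\<close> fixed, the error exponent is linear in
  \<open>R\<close> divided by \<open>R^2\<close>, so it vanishes as \<open>R\<close> tends to
  infinity. The linear numerator is where exponential type is decisive.\<close>

lemma imaginary_axis_lower_bound:
  assumes f: "f holomorphic_on UNIV" "f 0 = 1" "only_real_zeros f"
    and growth: "\<And>z. norm (f z) \<le> C * exp (D * norm z)" and "D \<ge> 0"
    and g: "\<And>z. f z = (\<Prod>x\<leftarrow>xs. 1 - z / complex_of_real x) * g z" "g holomorphic_on UNIV"
    and xs: "\<And>x. x \<in> set xs \<Longrightarrow> x \<noteq> 0"
  shows "(\<Prod>x\<leftarrow>xs. 1 + y\<^sup>2 / x\<^sup>2) \<le> norm (f (\<i> * of_real y) * f (- (\<i> * of_real y)))"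
proof -
  define T where "T R = (\<Prod>x\<leftarrow>xs. 1 + y\<^sup>2 / x\<^sup>2) * exp (- (512 * (\<bar>C\<bar> + 3 * D * R + 1) / R\<^sup>2 * y\<^sup>2))" for R
  have "((\<lambda>R::real. (\<bar>C\<bar> + 3 * D * R + 1) / R\<^sup>2) \<longlongrightarrow> 0) at_top"
    by real_asymp
  then have "((\<lambda>R. (\<Prod>x\<leftarrow>xs. 1 + y\<^sup>2 / x\<^sup>2) * exp (- (512 * ((\<bar>C\<bar> + 3 * D * R + 1) / R\<^sup>2) * y\<^sup>2))) \<longlongrightarrow>
      (\<Prod>x\<leftarrow>xs. 1 + y\<^sup>2 / x\<^sup>2) * exp (- (512 * 0 * y\<^sup>2))) at_top"
    by (intro tendsto_intros)
  then have lim: "(T \<longlongrightarrow> (\<Prod>x\<leftarrow>xs. 1 + y\<^sup>2 / x\<^sup>2)) at_top"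
    by (simp add: T_def[abs_def])
  have "\<forall>\<^sub>F R in at_top. T R \<le> norm (f (\<i> * of_real y) * f (- (\<i> * of_real y)))"
    using eventually_ge_at_top[of "4 * \<bar>y\<bar> + (\<Sum>x\<leftarrow>xs. \<bar>x\<bar>) + 1"]
  proof eventually_elim
    case (elim R)
    have sum: "\<bar>x\<bar> \<le> (\<Sum>x\<leftarrow>xs. \<bar>x\<bar>)" if "x \<in> set xs" for x
      by (rule member_le_sum_list) (use that in auto)
    have "0 \<le> (\<Sum>x\<leftarrow>xs. \<bar>x\<bar>)" by (rule sum_list_nonneg) auto
    with elim show ?case
      unfolding T_def using xs sum
      by (intro imaginary_axis_lower_bound_radius[OF f growth \<open>D \<ge> 0\<close> g]) fastforce+
  qed
  from tendsto_upperbound[OF lim this] show ?thesis by simp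
qed

text \<open>On the disc of radius \<open>2 * norm z\<close>, \<open>Borel_Caratheodory\<close> turns
  the one-sided bound into linear growth of \<open>norm (G z)\<close>; Liouville's theorem then
  leaves a polynomial of degree at most 1.\<close>

lemma linear_of_Re_bound:
  fixes a b :: real
  assumes G: "G holomorphic_on UNIV" "G 0 = 0" and Re: "\<And>z. r \<le> norm z \<Longrightarrow> Re (G z) \<le> a + b * norm z"
    and "b \<ge> 0"
  obtains \<beta> where "\<And>z. G z = \<beta> * z"
proof -
  have "bounded (G ` cball 0 r)"
    using G(1) by (intro compact_imp_bounded compact_continuous_image)
      (auto intro!: holomorphic_on_imp_continuous_on intro: holomorphic_on_subset)
  then obtain M where "\<forall>w\<in>G ` cball 0 r. norm w \<le> M"
    unfolding bounded_iff by blast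
  then have M: "Re (G z) \<le> M" if "norm z \<le> r" for z
    using that complex_Re_le_cmod[of "G z"] by force
  define c where "c = \<bar>M\<bar> + \<bar>a\<bar> + 1"
  have c: "Re (G z) < c + b * norm z" for z
  proof -
    have "Re (G z) \<le> M \<or> Re (G z) \<le> a + b * norm z" using M Re by (metis linear)
    moreover have "0 \<le> b * norm z" using \<open>b \<ge> 0\<close> by simp
    ultimately show ?thesis unfolding c_def by linarith
  qed
  have "norm (G z) \<le> (2 * c + 4 * b) * norm z ^ 1" if "1 \<le> norm z" for z
  proof -
    have "norm (G z) \<le> 2 * (c + b * (2 * norm z))"
    proof (rule Borel_Caratheodory[where L = G and R = "2 * norm z"])
      fix w :: complex assume "norm w < 2 * norm z"
      then have "b * norm w \<le> b * (2 * norm z)"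
        using \<open>b \<ge> 0\<close> by (intro mult_left_mono) auto
      then show "Re (G w) < c + b * (2 * norm z)" using c[of w] by linarith
    qed (use G that in \<open>auto intro: holomorphic_on_subset\<close>)
    also have "c * 1 \<le> c * norm z"
      using that by (intro mult_left_mono) (auto simp: c_def)
    then have "2 * (c + b * (2 * norm z)) \<le> (2 * c + 4 * b) * norm z ^ 1"
      by (simp add: algebra_simps)
    finally show ?thesis .
  qed
  from Liouville_polynomial[OF G(1) this]
  have "G z = deriv G 0 * z" for z using G(2) by simp
  then show thesis by (rule that)
qed

lemma only_real_zeros_exp_type:
  assumes f: "f holomorphic_on UNIV" "f 0 = 1" "only_real_zeros f"
    and growth: "\<And>z. norm (f z) \<le> C * exp (D * norm z)" and "D \<ge> 0"
    and poly: "\<And>y. y \<ge> 1 \<Longrightarrow> norm (f (\<i> * of_real y) * f (- (\<i> * of_real y))) \<le> B * y ^ k"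
  obtains xs \<beta> where "\<And>z. f z = (\<Prod>x\<leftarrow>xs. 1 - z / complex_of_real x) * exp (\<beta> * z)"
proof -
  have len: "length xs \<le> k"
    if "\<And>z. f z = (\<Prod>x\<leftarrow>xs. 1 - z / complex_of_real x) * g z" "g holomorphic_on UNIV"
      "\<And>x. x \<in> set xs \<Longrightarrow> x \<noteq> 0 \<and> complex_of_real x \<in> UNIV" for xs g
  proof (rule ccontr)
    assume "\<not> length xs \<le> k"
    \<comment> \<open>\<open>P\<close> is the leading coefficient, in powers of \<open>y\<close>, of
      the lower bound. More than \<open>k\<close> zeros would give
      \<open>P * y ^ Suc k \<le> B * y ^ k\<close>, that is \<open>y * P \<le> B\<close> for every
      \<open>y \<ge> 1\<close>, which fails at \<open>y = \<bar>B\<bar> / P + 1\<close>.\<close>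
    define P where "P = (\<Prod>x\<leftarrow>xs. 1 / x\<^sup>2)"
    have "P > 0" unfolding P_def using that(3) by (induction xs) auto
    have "y * P \<le> B" if "y \<ge> 1" for y
    proof -
      have eq: "(\<Prod>x\<leftarrow>xs. y\<^sup>2 / x\<^sup>2) = y\<^sup>2 ^ length xs * P"
        unfolding P_def by (induction xs) auto
      have "(\<Prod>x\<leftarrow>zs. y\<^sup>2 / x\<^sup>2) \<le> (\<Prod>x\<leftarrow>zs. 1 + y\<^sup>2 / x\<^sup>2) \<and> 0 \<le> (\<Prod>x\<leftarrow>zs. y\<^sup>2 / x\<^sup>2)" for zs
      proof (induction zs)
        case (Cons x zs)
        have "y\<^sup>2 / x\<^sup>2 * (\<Prod>x\<leftarrow>zs. y\<^sup>2 / x\<^sup>2) \<le> (1 + y\<^sup>2 / x\<^sup>2) * (\<Prod>x\<leftarrow>zs. 1 + y\<^sup>2 / x\<^sup>2)"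
          using Cons by (intro mult_mono) auto
        then show ?case using Cons by simp
      qed simp
      then have "(\<Prod>x\<leftarrow>xs. y\<^sup>2 / x\<^sup>2) \<le> B * y ^ k"
        using imaginary_axis_lower_bound[OF f growth \<open>D \<ge> 0\<close>, of xs g y] poly[OF \<open>y \<ge> 1\<close>]
          \<open>\<And>z. f z = _\<close> \<open>g holomorphic_on UNIV\<close> \<open>\<And>x. x \<in> set xs \<Longrightarrow> _\<close>
        by (meson order_trans)
      moreover have "y ^ Suc k \<le> y\<^sup>2 ^ length xs"
        unfolding power_mult[symmetric]
        by (intro power_increasing) (use \<open>\<not> length xs \<le> k\<close> \<open>y \<ge> 1\<close> in auto)
      then have "y ^ Suc k * P \<le> y\<^sup>2 ^ length xs * P"
        using \<open>P > 0\<close> by (intro mult_right_mono) auto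
      ultimately have "y ^ k * (y * P) \<le> y ^ k * B"
        unfolding eq by (simp add: mult_ac)
      then show ?thesis using \<open>y \<ge> 1\<close> by (simp add: mult_le_cancel_left)
    qed
    moreover have "(\<bar>B\<bar> / P + 1) * P = \<bar>B\<bar> + P" "\<bar>B\<bar> / P + 1 \<ge> 1"
      using \<open>P > 0\<close> by (simp_all add: field_simps)
    ultimately have "\<bar>B\<bar> + P \<le> B" by metis
    with \<open>P > 0\<close> show False by linarith
  qed
  obtain xs g where fg: "\<And>z. f z = (\<Prod>x\<leftarrow>xs. 1 - z / complex_of_real x) * g z" and g: "g holomorphic_on UNIV"
    and xs: "\<And>x. x \<in> set xs \<Longrightarrow> x \<noteq> 0 \<and> complex_of_real x \<in> UNIV" and nz: "\<And>z. z \<in> UNIV \<Longrightarrow> g z \<noteq> 0"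
    by (rule extract_real_zeros[OF f len that])
  have g0: "g 0 = 1"
    using fg[of 0] f(2) by (simp add: map_replicate_const)
  obtain G0 where G0: "G0 holomorphic_on UNIV" "\<And>z. exp (G0 z) = g z"
    using holomorphic_logarithm_exists[OF convex_UNIV open_UNIV g nz UNIV_I] by (metis UNIV_I)
  define G where "G z = G0 z - G0 0" for z
  have exp_G: "exp (G z) = g z" for z
    using G0(2)[of z] G0(2)[of 0] g0 by (simp add: G_def exp_diff)
  have C: "C \<ge> 1" using growth[of 0] f(2) by simp
  \<comment> \<open>So far out, all zeros lie within \<open>norm z / 3\<close>, and dividing by
    their factors does not worsen the growth bound of \<open>f\<close>.\<close>
  have "Re (G z) \<le> ln C + D * norm z" if z: "3 * ((\<Sum>x\<leftarrow>xs. \<bar>x\<bar>) + 1) \<le> norm z" for z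
  proof -
    have sum: "\<bar>x\<bar> \<le> (\<Sum>x\<leftarrow>xs. \<bar>x\<bar>)" if "x \<in> set xs" for x
      by (rule member_le_sum_list) (use that in auto)
    have "0 \<le> (\<Sum>x\<leftarrow>xs. \<bar>x\<bar>)" by (rule sum_list_nonneg) auto
    have "2 ^ length xs * norm (g z) \<le> C * exp (D * norm z)"
    proof (rule linear_factors_quotient_bound[OF fg g, where R = "norm z / 3"])
      show "x \<noteq> 0 \<and> \<bar>x\<bar> \<le> norm z / 3" if "x \<in> set xs" for x
        using xs[OF that] sum[OF that] z by simp
      show "norm (f w) \<le> C * exp (D * norm z)" if "norm w = 3 * (norm z / 3)" for w
        using growth[of w] that by simp
    qed (use z \<open>0 \<le> (\<Sum>x\<leftarrow>xs. \<bar>x\<bar>)\<close> in auto)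
    moreover have "1 * norm (g z) \<le> 2 ^ length xs * norm (g z)"
      by (intro mult_right_mono) auto
    ultimately have "exp (Re (G z)) \<le> exp (ln C + D * norm z)"
      using C exp_G[of z] by (simp add: exp_add flip: norm_exp_eq_Re)
    then show ?thesis by simp
  qed
  moreover have "G holomorphic_on UNIV" "G 0 = 0"
    unfolding G_def using G0(1) by (auto intro!: holomorphic_intros)
  ultimately obtain \<beta> where "\<And>z. G z = \<beta> * z"
    using linear_of_Re_bound \<open>D \<ge> 0\<close> by metis
  then have "f z = (\<Prod>x\<leftarrow>xs. 1 - z / complex_of_real x) * exp (\<beta> * z)" for z
    using fg[of z] exp_G[of z] by simp
  then show thesis by (rule that)
qed

section \<open>Growth on the imaginary axis\<close>

text \<open>A Gronwall argument for the sum \<open>E\<close> of the squared norms. The term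
  \<open>\<i> * \<omega> k * Y k\<close> is orthogonal to \<open>Y k\<close> over the reals and
  drops out of the derivative of \<open>E\<close>. The rest is at most \<open>K / t * E t\<close>,
  so \<open>E t / t ^ N\<close> is nonincreasing once \<open>N \<ge> K\<close>.\<close>

lemma energy_bound:
  fixes Y :: "nat \<Rightarrow> real \<Rightarrow> complex" and M :: "nat \<Rightarrow> nat \<Rightarrow> complex" and \<omega> :: "nat \<Rightarrow> real"
  assumes Y: "\<And>k t. k \<le> p \<Longrightarrow> t \<ge> 1 \<Longrightarrow>
    (Y k has_vector_derivative (\<Sum>l\<le>p. M k l * Y l t) / of_real t + \<i> * of_real (\<omega> k) * Y k t) (at t)"
  obtains C N where "\<And>k t. k \<le> p \<Longrightarrow> t \<ge> 1 \<Longrightarrow> (norm (Y k t))\<^sup>2 \<le> C * t ^ N"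
proof -
  define E where "E t = (\<Sum>k\<le>p. (norm (Y k t))\<^sup>2)" for t
  define E' where "E' t = (\<Sum>k\<le>p. 2 * (Y k t \<bullet> ((\<Sum>l\<le>p. M k l * Y l t) / of_real t)))" for t
  define K where "K = 2 * (\<Sum>k\<le>p. \<Sum>l\<le>p. norm (M k l))"
  define N where "N = nat \<lceil>K\<rceil>"
  have single_le: "(norm (Y k t))\<^sup>2 \<le> E t" if "k \<le> p" for k t
    unfolding E_def by (rule member_le_sum) (use that in auto)
  have E_nonneg: "0 \<le> E t" for t unfolding E_def by (intro sum_nonneg) auto
  have deriv_E: "(E has_real_derivative E' t) (at t)" if "t \<ge> 1" for t
  proof -
    have "((\<lambda>t. (norm (Y k t))\<^sup>2) has_real_derivative 2 * (Y k t \<bullet> ((\<Sum>l\<le>p. M k l * Y l t) / of_real t))) (at t)"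
      if "k \<le> p" for k
    proof -
      let ?D = "(\<Sum>l\<le>p. M k l * Y l t) / of_real t + \<i> * of_real (\<omega> k) * Y k t"
      have "((\<lambda>t. Y k t \<bullet> Y k t) has_vector_derivative (Y k t \<bullet> ?D + ?D \<bullet> Y k t)) (at t)"
        by (rule bounded_bilinear.has_vector_derivative[OF bounded_bilinear_inner]) (use Y that \<open>t \<ge> 1\<close> in auto)
      moreover have "Y k t \<bullet> (\<i> * of_real (\<omega> k) * Y k t) = 0"
        by (simp add: inner_complex_def algebra_simps)
      then have "Y k t \<bullet> ?D + ?D \<bullet> Y k t = 2 * (Y k t \<bullet> ((\<Sum>l\<le>p. M k l * Y l t) / of_real t))"
        unfolding inner_commute[of ?D] inner_add_right by simp
      ultimately show ?thesis
        by (simp only: has_real_derivative_iff_has_vector_derivative power2_norm_eq_inner)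
    qed
    then show ?thesis
      unfolding E_def[abs_def] E'_def by (intro DERIV_sum) auto
  qed
  have E'_le: "E' t \<le> K / t * E t" if "t \<ge> 1" for t
  proof -
    have pair: "norm (Y k t) * norm (Y l t) \<le> E t" if "k \<le> p" "l \<le> p" for k l
    proof -
      have "2 * (norm (Y k t) * norm (Y l t)) \<le> (norm (Y k t))\<^sup>2 + (norm (Y l t))\<^sup>2"
        using sum_squares_bound[of "norm (Y k t)" "norm (Y l t)"] by (simp add: mult.assoc)
      then show ?thesis using single_le[OF that(1), of t] single_le[OF that(2), of t] by linarith
    qed
    have "E' t \<le> (\<Sum>k\<le>p. 2 * ((\<Sum>l\<le>p. norm (M k l)) * E t / t))"
      unfolding E'_def
    proof (rule sum_mono)
      fix k assume k: "k \<in> {..p}"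
      have "Y k t \<bullet> ((\<Sum>l\<le>p. M k l * Y l t) / of_real t) \<le> norm (Y k t) * norm ((\<Sum>l\<le>p. M k l * Y l t) / of_real t)"
        by (rule norm_cauchy_schwarz)
      also have "\<dots> = norm (Y k t) * norm (\<Sum>l\<le>p. M k l * Y l t) / t"
        using that by (simp add: norm_divide)
      also have "norm (Y k t) * norm (\<Sum>l\<le>p. M k l * Y l t) \<le> norm (Y k t) * (\<Sum>l\<le>p. norm (M k l) * norm (Y l t))"
        by (intro mult_left_mono order_trans[OF norm_sum]) (auto simp: norm_mult)
      also have "\<dots> = (\<Sum>l\<le>p. norm (M k l) * (norm (Y k t) * norm (Y l t)))"
        by (simp add: sum_distrib_left mult_ac)
      also have "\<dots> \<le> (\<Sum>l\<le>p. norm (M k l) * E t)"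
        using pair k by (intro sum_mono mult_left_mono) auto
      also have "\<dots> = (\<Sum>l\<le>p. norm (M k l)) * E t" by (rule sum_distrib_right[symmetric])
      finally show "2 * (Y k t \<bullet> ((\<Sum>l\<le>p. M k l * Y l t) / of_real t)) \<le> 2 * ((\<Sum>l\<le>p. norm (M k l)) * E t / t)"
        using that by (simp add: divide_right_mono)
    qed
    also have "\<dots> = K / t * E t"
      unfolding K_def by (simp add: sum_distrib_left sum_distrib_right sum_divide_distrib mult_ac)
    finally show ?thesis .
  qed
  have "E t \<le> E 1 * t ^ N" if "t \<ge> 1" for t
  proof -
    have "E t / t ^ N \<le> E 1 / 1 ^ N"
    proof (rule DERIV_nonpos_imp_nonincreasing[OF that])
      fix x :: real assume "1 \<le> x" "x \<le> t"
      have "((\<lambda>x. E x / x ^ N) has_real_derivative (E' x * x ^ N - E x * (real N * x ^ (N - 1))) / (x ^ N * x ^ N)) (at x)"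
        by (rule DERIV_divide[OF deriv_E[OF \<open>1 \<le> x\<close>]]) (use \<open>1 \<le> x\<close> in \<open>auto intro!: derivative_eq_intros\<close>)
      moreover have "(E' x * x ^ N - E x * (real N * x ^ (N - 1))) / (x ^ N * x ^ N) \<le> 0"
      proof -
        have "E' x * x ^ N \<le> K / x * E x * x ^ N"
          using E'_le[OF \<open>1 \<le> x\<close>] \<open>1 \<le> x\<close> by (intro mult_right_mono) auto
        also have "\<dots> \<le> real N / x * E x * x ^ N"
          using \<open>1 \<le> x\<close> E_nonneg[of x] real_nat_ceiling_ge[of K]
          by (intro mult_right_mono divide_right_mono) (auto simp: N_def)
        also have "\<dots> = E x * (real N * x ^ (N - 1))"
          using \<open>1 \<le> x\<close> by (cases N) (auto simp: field_simps)
        finally show ?thesis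
          using \<open>1 \<le> x\<close> by (intro divide_nonpos_nonneg) auto
      qed
      ultimately show "\<exists>y. ((\<lambda>x. E x / x ^ N) has_real_derivative y) (at x) \<and> y \<le> 0" by blast
    qed
    then show ?thesis using that by (simp add: field_simps)
  qed
  then have "(norm (Y k t))\<^sup>2 \<le> E 1 * t ^ N" if "k \<le> p" "t \<ge> 1" for k t
    using single_le[OF that(1), of t] that(2) by (meson order_trans)
  then show thesis by (rule that)
qed

section \<open>The hypergeometric equation as a linear system\<close>

text \<open>With \<open>\<theta> = z d/dz\<close>, this is \<open>S(\<theta>) f\<close>.\<close>
definition theta_poly :: "complex poly \<Rightarrow> complex fps \<Rightarrow> complex fps" where
  "theta_poly S f = Abs_fps (\<lambda>n. poly S (of_nat n) * fps_nth f n)"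

text \<open>Horner's scheme in \<theta>. The form \<open>0 + of_nat n\<close> is the instance
  \<beta> = 0 of \<open>eval_fps_theta\<close>.\<close>

lemma theta_poly_pCons:
  "theta_poly (pCons a S) f = fps_const a * f + Abs_fps (\<lambda>n. (0 + of_nat n) * fps_nth (theta_poly S f) n)"
  by (rule fps_ext) (simp add: theta_poly_def algebra_simps)

lemma fps_conv_radius_theta_poly:
  assumes "fps_conv_radius f = \<infinity>"
  shows "fps_conv_radius (theta_poly S f) = \<infinity>"
proof (induction S)
  case 0
  have "theta_poly 0 f = 0" by (rule fps_ext) (simp add: theta_poly_def)
  then show ?case by simp
next
  case (pCons a S)
  let ?g = "Abs_fps (\<lambda>n. (0 + of_nat n) * fps_nth (theta_poly S f) n)"
  have "fps_conv_radius (fps_const a * f) = \<infinity>"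
    using fps_conv_radius_mult[of "fps_const a" f] assms by simp
  moreover have "fps_conv_radius ?g = \<infinity>"
    by (rule eval_fps_theta(1)[OF pCons(2)])
  ultimately show ?case
    unfolding theta_poly_pCons using fps_conv_radius_add[of "fps_const a * f" ?g] by simp
qed

lemma eval_fps_theta_poly_add:
  assumes "fps_conv_radius f = \<infinity>"
  shows "eval_fps (theta_poly (S + T) f) z = eval_fps (theta_poly S f) z + eval_fps (theta_poly T f) z"
proof -
  have "theta_poly (S + T) f = theta_poly S f + theta_poly T f"
    by (rule fps_ext) (simp add: theta_poly_def algebra_simps)
  then show ?thesis
    by (simp add: eval_fps_add fps_conv_radius_theta_poly[OF assms])
qed

lemma eval_fps_theta_poly_smult:
  assumes "fps_conv_radius f = \<infinity>"
  shows "eval_fps (theta_poly (smult c S) f) z = c * eval_fps (theta_poly S f) z"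
proof -
  have "theta_poly (smult c S) f = fps_const c * theta_poly S f"
    by (rule fps_ext) (simp add: theta_poly_def algebra_simps)
  then show ?thesis
    by (simp add: eval_fps_mult fps_conv_radius_theta_poly[OF assms])
qed

lemma eval_fps_theta_poly_sum:
  assumes "fps_conv_radius f = \<infinity>"
  shows "eval_fps (theta_poly (\<Sum>l\<in>I. smult (c l) (B l)) f) z = (\<Sum>l\<in>I. c l * eval_fps (theta_poly (B l) f) z)"
proof (induction I rule: infinite_finite_induct)
  case (insert x I)
  then show ?case
    by (simp add: eval_fps_theta_poly_add[OF assms] eval_fps_theta_poly_smult[OF assms])
qed (simp_all add: theta_poly_def eval_fps_def)

lemma eval_fps_theta_poly_pCons_0:
  assumes "fps_conv_radius f = \<infinity>"
  shows "eval_fps (theta_poly (pCons 0 S) f) z = z * deriv (eval_fps (theta_poly S f)) z"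
  using eval_fps_theta(2)[OF fps_conv_radius_theta_poly[OF assms], of 0 S z]
  unfolding theta_poly_pCons by simp

lemma degree_prod_list_linear:
  fixes as :: "complex list"
  shows "degree (\<Prod>a\<leftarrow>as. [:a, 1:]) = length as" "lead_coeff (\<Prod>a\<leftarrow>as. [:a, 1 :: complex:]) = 1"
proof -
  have *: "degree (\<Prod>a\<leftarrow>as. [:a, 1:]) = length as \<and> lead_coeff (\<Prod>a\<leftarrow>as. [:a, 1 :: complex:]) = 1"
  proof (induction as)
    case (Cons a as)
    then have "(\<Prod>a\<leftarrow>as. [:a, 1 :: complex:]) \<noteq> 0" by auto
    then have "degree ([:a, 1:] * (\<Prod>a\<leftarrow>as. [:a, 1 :: complex:])) = Suc (length as)"
      using Cons by (subst degree_mult_eq) auto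
    moreover have "lead_coeff [:a, 1 :: complex:] = 1" by simp
    then have "lead_coeff ([:a, 1:] * (\<Prod>a\<leftarrow>as. [:a, 1 :: complex:])) = 1"
      by (simp only: lead_coeff_mult conjunct2[OF Cons.IH] mult_1)
    ultimately show ?case by (simp only: list.map prod_list.Cons list.size simp_thms)
  qed simp
  show "degree (\<Prod>a\<leftarrow>as. [:a, 1:]) = length as" "lead_coeff (\<Prod>a\<leftarrow>as. [:a, 1 :: complex:]) = 1"
    using * by blast+
qed

lemma poly_prod_list_linear: "poly (\<Prod>a\<leftarrow>as. [:a, 1:]) x = (\<Prod>a\<leftarrow>as. x + a)" for x :: complex
  by (induction as) (auto simp: algebra_simps)

text \<open>The functions \<open>\<theta>\<^sup>k f\<close> for \<open>k < p\<close> together with \<open>\<Prod>(\<theta> + a) f\<close> satisfy a linear system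
  \<open>z Y' = (M + z J) Y\<close> with \<open>J = diag(0, \<dots>, 0, 1)\<close>. On the imaginary axis \<open>z J\<close> is skew-Hermitian, so
  only \<open>M\<close> contributes to the growth of \<open>\<parallel>Y\<parallel>\<^sup>2\<close>, which is therefore at most polynomial.\<close>
lemma hypergeometric_imaginary_axis_bound:
  fixes f :: "complex fps" and as bs :: "complex list"
  assumes f: "fps_conv_radius f = \<infinity>" and len: "length as = p" "length bs = p" "p > 0"
    and rec: "\<And>n. of_nat (Suc n) * fps_nth f (Suc n) * (\<Prod>b\<leftarrow>bs. of_nat n + b) = fps_nth f n * (\<Prod>a\<leftarrow>as. of_nat n + a)"
  obtains C N where "\<And>t. t \<ge> 1 \<Longrightarrow> (norm (eval_fps f (\<i> * of_real t)))\<^sup>2 \<le> C * t ^ N"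
proof -
  define A where "A = (\<Prod>a\<leftarrow>as. [:a, 1:])"
  \<comment> \<open>The shift by one rewrites the recurrence in terms of the upper index, so that it
    reads \<theta> A'(\<theta>) f = z A(\<theta>) f. Hence \<theta> A(\<theta>) f = z A(\<theta>) f
    + R(\<theta>) f, and \<open>R\<close> has degree at most \<open>p\<close> because
    \<open>A\<close> and \<open>A'\<close> are both monic of degree \<open>p\<close>.\<close>
  define A' where "A' = (\<Prod>b\<leftarrow>map (\<lambda>b. b - 1) bs. [:b, 1:])"
  define R where "R = pCons 0 (A - A')"
  \<comment> \<open>A basis of the polynomials of degree at most \<open>p\<close>, as
    \<open>A\<close> is monic of degree \<open>p\<close>; \<open>\<rho> S\<close> lists the
    coordinates of \<open>S\<close> in it.\<close>
  define B where "B k = (if k < p then monom 1 k else A)" for k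
  define \<rho> where "\<rho> S l = (if l < p then coeff S l - coeff S p * coeff A l else coeff S p)" for S l
  define F where "F S z = eval_fps (theta_poly S f) z" for S z
  have A: "degree A = p" "coeff A p = 1" and A': "degree A' = p" "coeff A' p = 1"
    using degree_prod_list_linear[of as] degree_prod_list_linear[of "map (\<lambda>b. b - 1) bs"] len
    by (auto simp: A_def A'_def)
  have span: "S = (\<Sum>l\<le>p. smult (\<rho> S l) (B l))" if "degree S \<le> p" for S
  proof (rule poly_eqI)
    fix n
    have "coeff (\<Sum>l\<le>p. smult (\<rho> S l) (B l)) n = (\<Sum>l<p. \<rho> S l * coeff (monom 1 l) n) + coeff S p * coeff A n"
      by (simp add: coeff_sum B_def \<rho>_def lessThan_Suc_atMost[symmetric])
    also have "(\<Sum>l<p. \<rho> S l * coeff (monom 1 l) n) = (if n < p then \<rho> S n else 0)"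
      by (simp add: if_distrib[of "(*) _"] cong: if_cong)
    also have "(if n < p then \<rho> S n else 0) + coeff S p * coeff A n = coeff S n"
      using that A coeff_eq_0[of S n] coeff_eq_0[of A n] by (cases n p rule: linorder_cases) (auto simp: \<rho>_def)
    finally show "coeff S n = coeff (\<Sum>l\<le>p. smult (\<rho> S l) (B l)) n" by simp
  qed
  have F_span: "F S z = (\<Sum>l\<le>p. \<rho> S l * F (B l) z)" if "degree S \<le> p" for S z
    unfolding F_def by (subst span[OF that]) (rule eval_fps_theta_poly_sum[OF f])
  have "degree (A - A') < p"
  proof -
    have "coeff (A - A') i = 0" if "i > p - 1" for i
      using that A A' coeff_eq_0[of A i] coeff_eq_0[of A' i] by (cases "i = p") auto
    then have "degree (A - A') \<le> p - 1"
      by (intro degree_le) auto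
    then show ?thesis using \<open>p > 0\<close> by linarith
  qed
  then have degR: "degree R \<le> p"
    by (auto simp: R_def)
  have FA: "F (pCons 0 A) z = z * F A z + F R z" for z
  proof -
    have "theta_poly (pCons 0 A) f = fps_X * theta_poly A f + theta_poly R f"
    proof (rule fps_ext)
      fix n
      show "fps_nth (theta_poly (pCons 0 A) f) n = fps_nth (fps_X * theta_poly A f + theta_poly R f) n"
      proof (cases n)
        case (Suc m)
        have "poly A' (of_nat (Suc m)) = (\<Prod>b\<leftarrow>bs. of_nat m + b)"
          unfolding A'_def poly_prod_list_linear by (simp add: o_def add.commute)
        moreover have "poly A (of_nat m) = (\<Prod>a\<leftarrow>as. of_nat m + a)"
          unfolding A_def poly_prod_list_linear ..
        ultimately have "of_nat (Suc m) * fps_nth f (Suc m) * poly A' (of_nat (Suc m)) = fps_nth f m * poly A (of_nat m)"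
          using rec[of m] by simp
        then show ?thesis
          by (simp add: Suc theta_poly_def R_def algebra_simps)
      qed (simp add: theta_poly_def R_def)
    qed
    then show ?thesis
      unfolding F_def using fps_conv_radius_mult[of fps_X "theta_poly A f"]
      by (simp add: eval_fps_add eval_fps_mult fps_conv_radius_theta_poly[OF f])
  qed
  define Y where "Y k t = F (B k) (\<i> * of_real t)" for k t
  define M where "M k = (if k < p then \<rho> (pCons 0 (B k)) else \<rho> R)" for k
  define \<omega> :: "nat \<Rightarrow> real" where "\<omega> k = (if k < p then 0 else 1)" for k
  have "(Y k has_vector_derivative (\<Sum>l\<le>p. M k l * Y l t) / of_real t + \<i> * of_real (\<omega> k) * Y k t) (at t)"
    if "k \<le> p" "t \<ge> 1" for k t
  proof -
    let ?z = "\<i> * complex_of_real t"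
    have "(F (B k) has_field_derivative deriv (F (B k)) ?z) (at ?z)"
      unfolding F_def[abs_def]
      by (rule holomorphic_derivI[where S = UNIV])
        (auto intro!: holomorphic_on_eval_fps simp: fps_conv_radius_theta_poly[OF f])
    moreover have "((\<lambda>t. \<i> * complex_of_real t) has_vector_derivative \<i>) (at t)"
      by (auto intro!: derivative_eq_intros has_vector_derivative_real_field)
    ultimately have "(Y k has_vector_derivative \<i> * deriv (F (B k)) ?z) (at t)"
      unfolding Y_def[abs_def] using field_vector_diff_chain_at[of "\<lambda>t. \<i> * complex_of_real t" \<i> t "F (B k)"]
      by (simp add: o_def)
    \<comment> \<open>Along z = i t the operator t d/dt agrees with \<theta>.\<close>
    moreover have "\<i> * deriv (F (B k)) ?z = F (pCons 0 (B k)) ?z / of_real t"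
      unfolding F_def using that eval_fps_theta_poly_pCons_0[OF f, of "B k" ?z]
      by (simp add: field_simps)
    moreover have "F (pCons 0 (B k)) ?z / of_real t = (\<Sum>l\<le>p. M k l * Y l t) / of_real t + \<i> * of_real (\<omega> k) * Y k t"
    proof (cases "k < p")
      case True
      then have "degree (pCons 0 (B k)) \<le> p"
        by (simp add: B_def degree_pCons_eq_if degree_monom_eq)
      from F_span[OF this] True show ?thesis by (simp add: M_def Y_def \<omega>_def)
    next
      case False
      then have "F (pCons 0 (B k)) ?z = ?z * F A ?z + F R ?z" by (simp add: B_def FA)
      with F_span[OF degR, of ?z] False that show ?thesis
        by (simp add: M_def Y_def \<omega>_def B_def field_simps)
    qed
    ultimately show ?thesis by simp
  qed
  then obtain C N where bound: "\<And>k t. k \<le> p \<Longrightarrow> t \<ge> 1 \<Longrightarrow> (norm (Y k t))\<^sup>2 \<le> C * t ^ N"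
    using energy_bound[of p Y M \<omega>] by blast
  have "theta_poly (B 0) f = f"
    using \<open>p > 0\<close> by (intro fps_ext) (simp add: theta_poly_def B_def)
  then show thesis
    using bound[of 0] that[of C N] by (simp add: Y_def F_def)
qed

section \<open>The functional equation for the coefficients\<close>

lemma proots_prod_list_linear: "proots (\<Prod>b\<leftarrow>bs. [:b, 1:]) = image_mset uminus (mset bs)"
  for bs :: "complex list"
proof (induction bs)
  case (Cons b bs)
  have nz: "(\<Prod>b\<leftarrow>bs. [:b, 1:]) \<noteq> (0 :: complex poly)"
    by (auto simp: prod_list_zero_iff)
  have "proots [:b, 1:] = {#- b#}"
    using proots_linear_factor[of "- b"] by simp
  moreover have "proots ([:b, 1:] * (\<Prod>b\<leftarrow>bs. [:b, 1:])) = proots [:b, 1:] + proots (\<Prod>b\<leftarrow>bs. [:b, 1:])"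
    using nz by (intro proots_mult) auto
  ultimately have "proots ([:b, 1:] * (\<Prod>b\<leftarrow>bs. [:b, 1:])) = {#- b#} + image_mset uminus (mset bs)"
    by (simp only: Cons.IH)
  then show ?case
    by (simp only: list.map prod_list.Cons) simp
qed simp

text \<open>A root \<open>r\<close> of \<open>Q\<close> such that \<open>r + 1\<close> is not a root must be some \<open>- b\<close>; cancelling the
  factor \<open>X - r\<close> replaces \<open>b\<close> by \<open>b + 1\<close> and lowers the degree of \<open>Q\<close>.\<close>
lemma shift_quotient_matching:
  fixes Q :: "complex poly"
  assumes "Q \<noteq> 0"
    and "pcompose Q [:1, 1:] * (\<Prod>b\<leftarrow>bs. [:b, 1:]) = Q * (\<Prod>a\<leftarrow>as. [:a, 1:])"
  shows "\<exists>ms :: nat list. length ms = length bs \<and> mset as = mset (map2 (\<lambda>b m. b + of_nat m) bs ms)"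
  using assms
proof (induction "degree Q" arbitrary: Q bs)
  case 0
  then obtain c where Q: "Q = [:c:]" using degree_eq_zeroE by metis
  then have "smult c (\<Prod>b\<leftarrow>bs. [:b, 1:]) = smult c (\<Prod>a\<leftarrow>as. [:a, 1:])" and "c \<noteq> 0"
    using 0 by auto
  then have "smult (inverse c) (smult c (\<Prod>b\<leftarrow>bs. [:b, 1:])) = smult (inverse c) (smult c (\<Prod>a\<leftarrow>as. [:a, 1:]))"
    by simp
  with \<open>c \<noteq> 0\<close> have "(\<Prod>b\<leftarrow>bs. [:b, 1:]) = (\<Prod>a\<leftarrow>as. [:a, 1:])"
    by simp
  then have "image_mset uminus (mset bs) = image_mset uminus (mset as)"
    by (metis proots_prod_list_linear)
  then have "image_mset uminus (image_mset uminus (mset bs)) = image_mset uminus (image_mset uminus (mset as))"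
    by simp
  then have "mset as = mset bs" by (simp add: multiset.map_comp o_def)
  moreover have "map2 (\<lambda>b m. b + of_nat m) bs (replicate (length bs) 0) = bs"
    by (rule nth_equalityI) auto
  ultimately show ?case
    by (intro exI[of _ "replicate (length bs) 0"]) simp
next
  case (Suc d)
  have "\<exists>r. poly Q r = 0 \<and> poly Q (r + 1) \<noteq> 0"
  proof (rule ccontr)
    assume "\<not> ?thesis"
    then have step: "\<And>r. poly Q r = 0 \<Longrightarrow> poly Q (r + 1) = 0" by blast
    obtain r where "poly Q r = 0"
      using alg_closed_imp_poly_has_root[of Q] Suc(2) by auto
    then have "poly Q (r + of_nat n) = 0" for n
    proof (induction n)
      case (Suc n)
      then show ?case using step[of "r + of_nat n"] by (simp add: add_ac)
    qed simp
    then have "range (\<lambda>n. r + of_nat n) \<subseteq> {x. poly Q x = 0}" by auto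
    moreover have "infinite (range (\<lambda>n. r + of_nat n))"
      by (rule range_inj_infinite) (auto simp: inj_on_def)
    ultimately show False
      using poly_roots_finite[OF \<open>Q \<noteq> 0\<close>] finite_subset by blast
  qed
  then obtain r where r: "poly Q r = 0" "poly Q (r + 1) \<noteq> 0" by blast
  have "poly (pcompose Q [:1, 1:] * (\<Prod>b\<leftarrow>bs. [:b, 1:])) r = 0"
    unfolding Suc(4) using r(1) by simp
  then have "poly (\<Prod>b\<leftarrow>bs. [:b, 1:]) r = 0"
    using r(2) by (simp add: poly_pcompose add.commute)
  then have "r \<in> set_mset (proots (\<Prod>b\<leftarrow>bs. [:b, 1:]))"
    by (subst set_count_proots) (auto simp: prod_list_zero_iff)
  then obtain b where b: "b \<in> set bs" "r = - b"
    unfolding proots_prod_list_linear by auto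
  then obtain us vs where bs: "bs = us @ b # vs"
    by (meson split_list)
  obtain Q1 where Q1: "Q = [:b, 1:] * Q1"
    using r(1) b(2) poly_eq_0_iff_dvd[of Q r] by (auto elim: dvdE)
  have "Q1 \<noteq> 0" using \<open>Q \<noteq> 0\<close> Q1 by auto
  \<comment> \<open>The factor \<open>X + b + 1\<close> split off from Q(X + 1) takes the place of
    \<open>X + b\<close> in the product over \<open>bs\<close>, and the released
    \<open>X + b\<close> cancels against the one in \<open>Q\<close>.\<close>
  have "pcompose Q [:1, 1:] = [:b + 1, 1:] * pcompose Q1 [:1, 1:]"
    unfolding Q1 pcompose_mult by (simp add: pcompose_pCons add.commute)
  then have "[:b, 1:] * (pcompose Q1 [:1, 1:] * (\<Prod>b\<leftarrow>us @ (b + 1) # vs. [:b, 1:]))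
      = [:b, 1:] * (Q1 * (\<Prod>a\<leftarrow>as. [:a, 1:]))"
    using Suc(4) unfolding Q1 bs by (simp only: map_append list.map prod_list.append prod_list.Cons mult_ac)
  moreover have "[:b, 1:] \<noteq> 0" by simp
  ultimately have "pcompose Q1 [:1, 1:] * (\<Prod>b\<leftarrow>us @ (b + 1) # vs. [:b, 1:]) = Q1 * (\<Prod>a\<leftarrow>as. [:a, 1:])"
    using mult_left_cancel by blast
  moreover have "d = degree Q1"
    using Suc(2) \<open>Q1 \<noteq> 0\<close> unfolding Q1 by (subst (asm) degree_mult_eq) auto
  ultimately obtain ms where ms: "length ms = length (us @ (b + 1) # vs)"
    "mset as = mset (map2 (\<lambda>b m. b + of_nat m) (us @ (b + 1) # vs) ms)"
    using Suc(1)[of Q1] \<open>Q1 \<noteq> 0\<close> by blast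
  \<comment> \<open>The increment of \<open>b\<close> is booked as one more natural step, since
    \<open>(b + 1) + m = b + Suc m\<close>.\<close>
  define ms' where "ms' = ms[length us := Suc (ms ! length us)]"
  have "map2 (\<lambda>b m. b + of_nat m) (us @ (b + 1) # vs) ms = map2 (\<lambda>b m. b + of_nat m) bs ms'"
    using ms(1) unfolding ms'_def bs
    by (intro nth_equalityI) (auto simp: nth_append nth_list_update nth_Cons' algebra_simps)
  then show ?case
    using ms by (intro exI[of _ ms']) (simp add: ms'_def bs)
qed

text \<open>Multiplication by z replaces the n-th value of \<open>fact n * fps_nth _ n\<close> by n
  times its predecessor, so \<open>Q\<close> turns into X Q(X - 1) / \<beta>. The factor X also
  gives the right value 0 at n = 0, where there is no predecessor.\<close>

lemma poly_times_exp_coeffs: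
  fixes P :: "complex poly"
  assumes "\<beta> \<noteq> 0"
  shows "\<exists>Q. \<forall>n. fact n * fps_nth (fps_of_poly P * fps_exp \<beta>) n = \<beta> ^ n * poly Q (of_nat n)"
proof (induction P)
  case (pCons a P)
  then obtain Q where Q: "\<And>n. fact n * fps_nth (fps_of_poly P * fps_exp \<beta>) n = \<beta> ^ n * poly Q (of_nat n)"
    by blast
  have eq: "fps_of_poly (pCons a P) * fps_exp \<beta> = fps_const a * fps_exp \<beta> + fps_X * (fps_of_poly P * fps_exp \<beta>)"
    by (simp add: fps_of_poly_pCons algebra_simps)
  have "fact n * fps_nth (fps_of_poly (pCons a P) * fps_exp \<beta>) n =
      \<beta> ^ n * poly ([:a:] + smult (1 / \<beta>) (pCons 0 (pcompose Q [:-1, 1:]))) (of_nat n)" for n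
  proof (cases n)
    case (Suc m)
    have "fact n * fps_nth (fps_of_poly (pCons a P) * fps_exp \<beta>) n =
        a * \<beta> ^ n + of_nat (Suc m) * (fact m * fps_nth (fps_of_poly P * fps_exp \<beta>) m)"
    proof -
      have "fact n * fps_nth (fps_const a * fps_exp \<beta>) n = a * \<beta> ^ n" by simp
      moreover have "fact n * fps_nth (fps_X * (fps_of_poly P * fps_exp \<beta>)) n =
          of_nat (Suc m) * (fact m * fps_nth (fps_of_poly P * fps_exp \<beta>) m)"
        unfolding Suc by (simp only: fact_Suc fps_X_mult_nth nat.case diff_Suc_1 nat.distinct if_False mult.assoc)
      ultimately show ?thesis
        unfolding eq fps_add_nth distrib_left by simp
    qed
    also have "\<dots> = \<beta> ^ n * (a + 1 / \<beta> * (of_nat n * poly Q (of_nat m)))"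
      unfolding Q Suc using assms by (simp add: field_simps)
    finally show ?thesis by (simp add: Suc poly_pcompose)
  qed (simp add: eq)
  then show ?case by blast
qed (simp add: exI[of _ 0])

lemma exp_form_imp_matching:
  fixes f :: "complex fps" and as bs :: "complex list"
  assumes f: "f = fps_of_poly P * fps_exp \<beta>" and nz: "\<And>n. fps_nth f n \<noteq> 0"
    and len: "length as = length bs"
    and rec: "\<And>n. of_nat (Suc n) * fps_nth f (Suc n) * (\<Prod>b\<leftarrow>bs. of_nat n + b) = fps_nth f n * (\<Prod>a\<leftarrow>as. of_nat n + a)"
  shows "\<exists>ms :: nat list. length ms = length bs \<and> mset as = mset (map2 (\<lambda>b m. b + of_nat m) bs ms)"
proof -
  have "\<beta> \<noteq> 0"
  proof
    assume "\<beta> = 0"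
    then have "fps_nth f (Suc (degree P)) = 0"
      unfolding f by (simp add: coeff_eq_0)
    with nz show False by blast
  qed
  then obtain Q where Q: "\<And>n. fact n * fps_nth f n = \<beta> ^ n * poly Q (of_nat n)"
    using poly_times_exp_coeffs[of \<beta> P] unfolding f by blast
  have "Q \<noteq> 0"
    using Q[of 0] nz[of 0] by auto
  define A where "A = (\<Prod>a\<leftarrow>as. [:a, 1:])"
  define B where "B = (\<Prod>b\<leftarrow>bs. [:b, 1:])"
  define D where "D = smult \<beta> (pcompose Q [:1, 1:] * B) - Q * A"
  have "poly D (of_nat n) = 0" for n
  proof -
    have "\<beta> ^ Suc n * poly Q (of_nat (Suc n)) * poly B (of_nat n)
        = fact n * (of_nat (Suc n) * fps_nth f (Suc n) * (\<Prod>b\<leftarrow>bs. of_nat n + b))"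
      unfolding Q[symmetric] B_def poly_prod_list_linear by (simp only: fact_Suc mult_ac)
    also have "\<dots> = \<beta> ^ n * poly Q (of_nat n) * poly A (of_nat n)"
      unfolding rec Q[symmetric] A_def poly_prod_list_linear by (simp add: mult_ac)
    finally have "\<beta> ^ n * poly D (of_nat n) = 0"
      by (simp add: D_def poly_pcompose algebra_simps)
    then show ?thesis using \<open>\<beta> \<noteq> 0\<close> by simp
  qed
  then have "range of_nat \<subseteq> {x. poly D x = 0}" by auto
  moreover have "infinite (range (of_nat :: nat \<Rightarrow> complex))"
    by (rule range_inj_infinite) (rule inj_of_nat)
  ultimately have "D = 0"
    using poly_roots_finite[of D] finite_subset by blast
  then have eq: "smult \<beta> (pcompose Q [:1, 1:] * B) = Q * A" by (simp add: D_def)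
  \<comment> \<open>The products \<open>A\<close> and \<open>B\<close> are monic and the
    substitution X -> X + 1 keeps the leading coefficient, so the exponent \<beta> can only be
    1.\<close>
  have "lead_coeff (smult \<beta> (pcompose Q [:1, 1:] * B)) = \<beta> * lead_coeff Q"
    using degree_prod_list_linear(2)[of bs] by (simp add: lead_coeff_mult lead_coeff_comp B_def)
  moreover have "lead_coeff (Q * A) = lead_coeff Q"
    using degree_prod_list_linear(2)[of as] by (simp add: lead_coeff_mult A_def)
  ultimately have "\<beta> = 1" using eq \<open>Q \<noteq> 0\<close> by auto
  then show ?thesis
    using shift_quotient_matching[OF \<open>Q \<noteq> 0\<close>, of bs as] eq unfolding A_def B_def by simp
qed

section \<open>Hypergeometric series\<close>

lemma pochhammer_nonzero:
  assumes "a \<notin> \<int>\<^sub>\<le>\<^sub>0"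
  shows "pochhammer (a :: complex) n \<noteq> 0"
  using assms by (auto simp: pochhammer_eq_0_iff)

lemma fps_hypergeo_nth_prod_list:
  "fps_nth (fps_hypergeo as bs 1) n = (\<Prod>a\<leftarrow>as. pochhammer a n) / (\<Prod>b\<leftarrow>bs. pochhammer b n) / fact n"
proof -
  have fold: "foldl (\<lambda>r a. r * pochhammer a n) v xs = v * (\<Prod>a\<leftarrow>xs. pochhammer a n)" for v xs
    by (induction xs arbitrary: v) (simp_all add: mult.assoc)
  show ?thesis by (simp add: fold)
qed

lemma inverse_shift_bounded:
  fixes b :: complex
  obtains K where "\<And>k. norm (inverse (b + of_nat k)) \<le> K" "K \<ge> 0"
proof -
  have "filterlim (\<lambda>k. b + of_nat k) at_infinity sequentially"
    by (rule tendsto_add_filterlim_at_infinity[OF tendsto_const tendsto_of_nat])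
  then have "(\<lambda>k. inverse (b + of_nat k)) \<longlonglongrightarrow> 0"
    using filterlim_compose[OF tendsto_inverse_0] by blast
  then have "Bseq (\<lambda>k. inverse (b + of_nat k))"
    by (rule convergent_imp_Bseq[OF convergentI])
  then show thesis
    using that by (auto elim!: BseqE) (meson less_imp_le)
qed

text \<open>Each \<open>a\<close> is paired with some \<open>b\<close>: the ratios
  \<open>(a + k) / (b + k) = 1 + (a - b) / (b + k)\<close> are bounded in \<open>k\<close>, and so
  are the \<open>1 / (b + k)\<close> of an unpaired \<open>b\<close>. After division by
  \<open>fact n\<close>, a geometric bound on the coefficients is exponential type with constant
  \<open>C = 1\<close>.\<close>

lemma pochhammer_quotient_bound:
  fixes as bs :: "complex list"
  assumes "length as \<le> length bs" and "\<forall>b\<in>set bs. b \<notin> \<int>\<^sub>\<le>\<^sub>0"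
  shows "\<exists>D\<ge>0. \<forall>n. norm ((\<Prod>a\<leftarrow>as. pochhammer a n) / (\<Prod>b\<leftarrow>bs. pochhammer b n)) \<le> D ^ n"
  using assms
proof (induction bs arbitrary: as)
  case Nil
  then show ?case by (intro exI[of _ 1]) auto
next
  case (Cons b bs)
  have nz: "b + of_nat k \<noteq> 0" for k
    using Cons.prems(2) pochhammer_nonzero[of b "Suc k"] by (simp add: pochhammer_Suc)
  obtain K where K: "\<And>k. norm (inverse (b + of_nat k)) \<le> K" "K \<ge> 0"
    using inverse_shift_bounded[of b] by blast
  have poch: "norm (pochhammer a n / pochhammer b n) \<le> (1 + norm (a - b) * K) ^ n" for a n
  proof -
    have "norm ((a + of_nat k) / (b + of_nat k)) \<le> 1 + norm (a - b) * K" for k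
    proof -
      have "(a + of_nat k) / (b + of_nat k) = 1 + (a - b) * inverse (b + of_nat k)"
        using nz[of k] by (simp add: field_simps)
      then show ?thesis
        using norm_triangle_ineq[of 1 "(a - b) * inverse (b + of_nat k)"] mult_left_mono[OF K(1)[of k], of "norm (a - b)"]
        by (simp add: norm_mult)
    qed
    then have "(\<Prod>k = 0..<n. norm ((a + of_nat k) / (b + of_nat k))) \<le> (\<Prod>k = 0..<n. 1 + norm (a - b) * K)"
      by (intro prod_mono) auto
    then show ?thesis
      by (simp add: pochhammer_prod prod_dividef norm_divide prod_norm)
  qed
  have poch1: "norm (1 / pochhammer b n) \<le> K ^ n" for n
  proof -
    have "(\<Prod>k = 0..<n. norm (inverse (b + of_nat k))) \<le> (\<Prod>k = 0..<n. K)"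
      using K by (intro prod_mono) auto
    then show ?thesis
      by (simp add: pochhammer_prod norm_divide norm_inverse prod_inversef[symmetric] prod_norm inverse_eq_divide prod_dividef)
  qed
  show ?case
  proof (cases as)
    case Nil
    obtain D where D: "D \<ge> 0" "\<And>n. norm ((\<Prod>a\<leftarrow>[]. pochhammer a n) / (\<Prod>b\<leftarrow>bs. pochhammer b n)) \<le> D ^ n"
      using Cons.IH[of "[]"] Cons.prems by auto
    have "norm ((\<Prod>a\<leftarrow>as. pochhammer a n) / (\<Prod>b\<leftarrow>b # bs. pochhammer b n)) \<le> (K * D) ^ n" for n
    proof -
      have "norm (1 / pochhammer b n) * norm ((\<Prod>a\<leftarrow>[]. pochhammer a n) / (\<Prod>b\<leftarrow>bs. pochhammer b n)) \<le> K ^ n * D ^ n"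
        using poch1[of n] D K by (intro mult_mono) auto
      then show ?thesis by (simp add: Nil norm_mult norm_divide power_mult_distrib)
    qed
    then show ?thesis using D K by (intro exI[of _ "K * D"]) auto
  next
    case (Cons a as')
    obtain D where D: "D \<ge> 0" "\<And>n. norm ((\<Prod>a\<leftarrow>as'. pochhammer a n) / (\<Prod>b\<leftarrow>bs. pochhammer b n)) \<le> D ^ n"
      using Cons.IH[of as'] Cons.prems Cons by auto
    have "norm ((\<Prod>a\<leftarrow>as. pochhammer a n) / (\<Prod>b\<leftarrow>b # bs. pochhammer b n)) \<le> ((1 + norm (a - b) * K) * D) ^ n" for n
    proof -
      have "norm (pochhammer a n / pochhammer b n) * norm ((\<Prod>a\<leftarrow>as'. pochhammer a n) / (\<Prod>b\<leftarrow>bs. pochhammer b n))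
          \<le> (1 + norm (a - b) * K) ^ n * D ^ n"
        using poch[of a n] D K by (intro mult_mono) auto
      then show ?thesis by (simp add: Cons norm_mult norm_divide power_mult_distrib)
    qed
    then show ?thesis using D K by (intro exI[of _ "(1 + norm (a - b) * K) * D"]) auto
  qed
qed

lemma fps_hypergeo_entire:
  fixes as bs :: "complex list"
  assumes "length as \<le> length bs" and "\<forall>b\<in>set bs. b \<notin> \<int>\<^sub>\<le>\<^sub>0"
  shows "fps_conv_radius (fps_hypergeo as bs 1) = \<infinity>"
    and "\<exists>D\<ge>0. \<forall>z. norm (hypergeo as bs z) \<le> 1 * exp (D * norm z)"
proof -
  obtain D where D: "D \<ge> 0" "\<And>n. norm ((\<Prod>a\<leftarrow>as. pochhammer a n) / (\<Prod>b\<leftarrow>bs. pochhammer b n)) \<le> D ^ n"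
    using pochhammer_quotient_bound[OF assms] by blast
  have le: "norm (fps_nth (fps_hypergeo as bs 1) n) \<le> D ^ n / fact n" for n
    using D(2)[of n] unfolding fps_hypergeo_nth_prod_list norm_divide[of _ "fact n"] by (simp add: divide_right_mono)
  show "fps_conv_radius (fps_hypergeo as bs 1) = \<infinity>"
    by (rule fps_conv_radius_eq_infinityI[where g = "fps_exp (of_real D)"])
      (use le D(1) in \<open>auto simp: norm_divide norm_power simp del: fps_hypergeo_nth\<close>)
  have "norm (hypergeo as bs z) \<le> exp (D * norm z)" for z
  proof -
    have sums: "(\<lambda>n. (D * norm z) ^ n /\<^sub>R fact n) sums exp (D * norm z)"
      by (rule exp_converges)
    have "norm (\<Sum>n. fps_nth (fps_hypergeo as bs 1) n * z ^ n) \<le> (\<Sum>n. (D * norm z) ^ n /\<^sub>R fact n)"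
    proof (rule norm_suminf_le)
      fix n
      have "norm (fps_nth (fps_hypergeo as bs 1) n * z ^ n) \<le> D ^ n / fact n * norm z ^ n"
        unfolding norm_mult norm_power by (intro mult_right_mono le) auto
      then show "norm (fps_nth (fps_hypergeo as bs 1) n * z ^ n) \<le> (D * norm z) ^ n /\<^sub>R fact n"
        by (simp add: power_mult_distrib field_simps del: fps_hypergeo_nth)
    qed (use sums in \<open>auto simp: sums_iff\<close>)
    then show ?thesis using sums by (simp add: hypergeo_def eval_fps_def sums_iff)
  qed
  then show "\<exists>D\<ge>0. \<forall>z. norm (hypergeo as bs z) \<le> 1 * exp (D * norm z)"
    using D(1) by auto
qed

lemma fps_hypergeo_nth_nonzero:
  fixes as bs :: "complex list"
  assumes "\<forall>a\<in>set as. a \<notin> \<int>\<^sub>\<le>\<^sub>0" and "\<forall>b\<in>set bs. b \<notin> \<int>\<^sub>\<le>\<^sub>0"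
  shows "fps_nth (fps_hypergeo as bs 1) n \<noteq> 0"
  using assms pochhammer_nonzero unfolding fps_hypergeo_nth_prod_list by (auto simp: prod_list_zero_iff)

lemma fps_hypergeo_recurrence:
  fixes as bs :: "complex list"
  assumes "\<forall>b\<in>set bs. b \<notin> \<int>\<^sub>\<le>\<^sub>0"
  shows "of_nat (Suc n) * fps_nth (fps_hypergeo as bs 1) (Suc n) * (\<Prod>b\<leftarrow>bs. of_nat n + b) =
    fps_nth (fps_hypergeo as bs 1) n * (\<Prod>a\<leftarrow>as. of_nat n + a)"
proof -
  have Suc: "(\<Prod>x\<leftarrow>xs. pochhammer x (Suc n)) = (\<Prod>x\<leftarrow>xs. pochhammer x n) * (\<Prod>x\<leftarrow>xs. of_nat n + x)" for xs :: "complex list"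
    by (induction xs) (auto simp: pochhammer_Suc add.commute)
  have "(\<Prod>b\<leftarrow>bs. pochhammer b (Suc n)) \<noteq> 0"
    using assms pochhammer_nonzero by (auto simp: prod_list_zero_iff)
  then have "(\<Prod>b\<leftarrow>bs. pochhammer b n) \<noteq> 0" "(\<Prod>b\<leftarrow>bs. of_nat n + b) \<noteq> 0"
    unfolding Suc by auto
  moreover have "of_nat (Suc n) * (A * A' / (B * B') / (of_nat (Suc n) * fact n)) * B' = A / B / fact n * A'"
    if "B \<noteq> 0" "B' \<noteq> 0" for A A' B B' :: complex
    using that by (simp add: field_simps del: of_nat_Suc)
  ultimately show ?thesis
    unfolding fps_hypergeo_nth_prod_list Suc fact_Suc by blast
qed

text \<open>The coefficient of z does not vanish. Hurwitz' theorem asks for a nonconstant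
  limit.\<close>

lemma hypergeo_nonconstant:
  fixes as bs :: "complex list"
  assumes "length as \<le> length bs" and "\<forall>a\<in>set as. a \<notin> \<int>\<^sub>\<le>\<^sub>0" and "\<forall>b\<in>set bs. b \<notin> \<int>\<^sub>\<le>\<^sub>0"
  shows "\<not> hypergeo as bs constant_on UNIV"
proof
  assume "hypergeo as bs constant_on UNIV"
  then obtain c where "hypergeo as bs = (\<lambda>_. c)"
    by (auto simp: constant_on_def)
  then have "deriv (eval_fps (fps_hypergeo as bs 1)) 0 = 0"
    unfolding hypergeo_def[abs_def] by simp
  moreover have "fps_nth (fps_hypergeo as bs 1) 1 = deriv (eval_fps (fps_hypergeo as bs 1)) 0"
    using fps_nth_conv_deriv[of "fps_hypergeo as bs 1" 1] fps_hypergeo_entire(1)[OF assms(1,3)] by (simp del: fps_hypergeo_nth)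
  ultimately show False
    using fps_hypergeo_nth_nonzero[OF assms(2,3)] by metis
qed

lemma hypergeo_0: "hypergeo as bs 0 = 1"
  unfolding hypergeo_def eval_fps_at_0 by (rule fps_hypergeo_0)

text \<open>Hurwitz' theorem is applied on the open upper and lower half-planes, where no
  \<open>F n\<close> vanishes. The identity theorem carries nonconstancy from the plane over to each
  of them.\<close>

lemma only_real_zeros_limit:
  assumes F: "\<And>n. F n holomorphic_on UNIV" "\<And>n. only_real_zeros (F n)" and f: "f holomorphic_on UNIV"
    and lim: "\<And>R. uniform_limit (cball 0 R) F f sequentially" and nonconst: "\<not> f constant_on UNIV"
  shows "only_real_zeros f"
proof -
  have nz: "f z \<noteq> 0" if S: "open S" "connected S" "S \<inter> \<real> = {}" and "z \<in> S" for S z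
  proof (rule Hurwitz_no_zeros[OF S(1,2) _ _ _ _ _ \<open>z \<in> S\<close>])
    show "F n holomorphic_on S" for n using F(1) by (rule holomorphic_on_subset) auto
    show "f holomorphic_on S" using f by (rule holomorphic_on_subset) auto
    show "uniform_limit K F f sequentially" if "compact K" for K
      using lim that by (rule uniform_limit_compactI)
    show "\<not> f constant_on S"
    proof
      assume "f constant_on S"
      then obtain c where c: "\<And>w. w \<in> S \<Longrightarrow> f w = c" by (auto simp: constant_on_def)
      have "f w = c" for w
        by (rule analytic_continuation_open[of S UNIV f "\<lambda>_. c"]) (use S \<open>z \<in> S\<close> f c in auto)
      with nonconst show False by (auto simp: constant_on_def)
    qed
    show "F n w \<noteq> 0" if "w \<in> S" for n w
      using F(2)[of n] S(3) that by (auto simp: only_real_zeros_def)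
  qed
  show ?thesis
    unfolding only_real_zeros_def
  proof (intro allI impI, rule ccontr)
    fix z assume "f z = 0" "z \<notin> \<real>"
    then have "Im z > 0 \<or> Im z < 0" by (auto simp: complex_is_Real_iff)
    then show False
    proof
      assume "Im z > 0"
      then show False
        using nz[of "{z. Im z > 0}" z] \<open>f z = 0\<close> open_halfspace_Im_gt[of 0] convex_connected[OF convex_halfspace_Im_gt[of 0]]
        by (force simp: complex_is_Real_iff)
    next
      assume "Im z < 0"
      then show False
        using nz[of "{z. Im z < 0}" z] \<open>f z = 0\<close> open_halfspace_Im_lt[of 0] convex_connected[OF convex_halfspace_Im_lt[of 0]]
        by (force simp: complex_is_Real_iff)
    qed
  qed
qed

text \<open>The zero polynomial counts as negative-real-rooted, so an approximating sequence may
  contain it. Convergence at the origin to \<open>f 0 \<noteq> 0\<close> excludes it from some index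
  \<open>N\<close> on, and the sequence is started there.\<close>

lemma LP_plus_only_real_zeros:
  assumes "f \<in> LP_plus" and "f 0 \<noteq> 0" and "\<not> f constant_on UNIV"
  shows "only_real_zeros f"
proof -
  obtain P where P: "f holomorphic_on UNIV" "\<And>n. negative_real_rooted (P n)"
    and lim: "\<And>R. uniform_limit (cball 0 R) (\<lambda>n. poly (P n)) f sequentially"
    using LP_plusE[OF assms(1)] by blast
  have "(\<lambda>n. poly (P n) 0) \<longlonglongrightarrow> f 0"
    using lim[of 0] by (rule tendsto_uniform_limitI) simp
  then have "\<forall>\<^sub>F n in sequentially. poly (P n) 0 \<noteq> 0"
    using assms(2) by (rule tendsto_imp_eventually_ne)
  then obtain N where N: "\<And>n. n \<ge> N \<Longrightarrow> poly (P n) 0 \<noteq> 0"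
    by (auto simp: eventually_sequentially)
  show ?thesis
  proof (rule only_real_zeros_limit[where F = "\<lambda>n. poly (P (n + N))"])
    fix n
    have "P (n + N) \<noteq> 0" using N[of "n + N"] by auto
    then show "only_real_zeros (poly (P (n + N)))"
      using P(2)[of "n + N"] nonpos_Reals_subset_Reals
      by (auto simp: only_real_zeros_def negative_real_rooted_def complex_nonpos_Reals_iff complex_is_Real_iff)
    show "uniform_limit (cball 0 R) (\<lambda>n. poly (P (n + N))) f sequentially" for R
      using lim[of R] by (rule filterlim_compose) (rule filterlim_add_const_nat_at_top)
  qed (use P assms(3) in \<open>auto intro: holomorphic_intros\<close>)
qed

section \<open>Matched parameters lead into LP+\<close>

lemma nonpos_Ints_of_real_iff [simp]: "complex_of_real x \<in> \<int>\<^sub>\<le>\<^sub>0 \<longleftrightarrow> x \<in> \<int>\<^sub>\<le>\<^sub>0"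
  by (auto simp: nonpos_Ints_def) (metis of_real_eq_iff of_real_of_int_eq)

lemma pos_not_nonpos_Ints: "x > 0 \<Longrightarrow> (x :: real) \<notin> \<int>\<^sub>\<le>\<^sub>0"
  using nonpos_Ints_nonpos by force

lemma LP_plus_hypergeo_lower:
  assumes "\<forall>x\<in>set c. x > 0"
  shows "fps_conv_radius (Abs_fps (\<lambda>n. 1 / (\<Prod>x\<leftarrow>c. pochhammer (complex_of_real x) n) / fact n)) = \<infinity> \<and>
    eval_fps (Abs_fps (\<lambda>n. 1 / (\<Prod>x\<leftarrow>c. pochhammer (complex_of_real x) n) / fact n)) \<in> LP_plus"
  using assms
proof (induction c)
  case Nil
  have "Abs_fps (\<lambda>n. 1 / fact n) = fps_exp (1 :: complex)"
    by (rule fps_ext) simp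
  moreover have "eval_fps (fps_exp (1 :: complex)) = exp"
    by (simp add: fun_eq_iff)
  ultimately show ?case using exp_in_LP_plus by simp
next
  case (Cons x c)
  then show ?case
    using LP_plus_divide_pochhammer[of "Abs_fps (\<lambda>n. 1 / (\<Prod>x\<leftarrow>c. pochhammer (complex_of_real x) n) / fact n)" x]
    by (simp add: divide_divide_eq_left mult_ac)
qed

text \<open>The series is assembled from that of \<open>exp\<close>: dividing by the Pochhammer
  symbols of \<open>c\<close> comes first, then each of the \<open>p\<close> pairs contributes one
  ratio as in \<open>LP_plus_pochhammer_ratio\<close>. The permutation merely reorders the product
  over \<open>a\<close>.\<close>

lemma LP_plus_hypergeo_matched:
  fixes a b :: "real list" and m :: "nat \<Rightarrow> nat"
  assumes len: "length a = p" "length b = p" and b: "\<forall>x\<in>set b. x > 0" and c: "\<forall>x\<in>set c. x > 0"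
    and \<sigma>: "\<sigma> permutes {..<p}" and eq: "\<forall>i<p. a ! \<sigma> i = b ! i + real (m i)"
  shows "hypergeo (map complex_of_real a) (map complex_of_real (b @ c)) \<in> LP_plus"
proof -
  define G where "G k = Abs_fps (\<lambda>n. (\<Prod>i<k. pochhammer (of_real (b ! i + real (m i))) n / pochhammer (complex_of_real (b ! i)) n) *
    (1 / (\<Prod>x\<leftarrow>c. pochhammer (complex_of_real x) n) / fact n))" for k
  have "fps_conv_radius (G k) = \<infinity> \<and> eval_fps (G k) \<in> LP_plus" if "k \<le> p" for k
    using that
  proof (induction k)
    case 0
    then show ?case using LP_plus_hypergeo_lower[OF c] by (simp add: G_def)
  next
    case (Suc k)
    have "b ! k > 0" using Suc len b by simp
    moreover have "G (Suc k) = Abs_fps (\<lambda>n. pochhammer (of_real (b ! k + real (m k))) n / pochhammer (of_real (b ! k)) n * fps_nth (G k) n)"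
      by (rule fps_ext) (simp add: G_def)
    ultimately show ?case
      using LP_plus_pochhammer_ratio[of "G k" "b ! k" "m k"] Suc by simp
  qed
  then have "eval_fps (G p) \<in> LP_plus" by simp
  moreover have "G p = fps_hypergeo (map complex_of_real a) (map complex_of_real (b @ c)) 1"
  proof (rule fps_ext)
    fix n
    have "(\<Prod>x\<leftarrow>map complex_of_real a. pochhammer x n) = (\<Prod>i<p. pochhammer (complex_of_real (a ! i)) n)"
      by (simp add: prod.list_conv_set_nth len atLeast0LessThan)
    also have "\<dots> = (\<Prod>i<p. pochhammer (complex_of_real (a ! \<sigma> i)) n)"
      using prod.permute[OF \<sigma>, of "\<lambda>i. pochhammer (complex_of_real (a ! i)) n"] by (simp add: o_def)
    also have "\<dots> = (\<Prod>i<p. pochhammer (complex_of_real (b ! i + real (m i))) n)"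
      using eq by (intro prod.cong) auto
    finally have a: "(\<Prod>x\<leftarrow>map complex_of_real a. pochhammer x n) = (\<Prod>i<p. pochhammer (complex_of_real (b ! i + real (m i))) n)" .
    have b: "(\<Prod>x\<leftarrow>map complex_of_real b. pochhammer x n) = (\<Prod>i<p. pochhammer (complex_of_real (b ! i)) n)"
      by (simp add: prod.list_conv_set_nth len atLeast0LessThan)
    have c: "(\<Prod>x\<leftarrow>map complex_of_real c. pochhammer x n) = (\<Prod>x\<leftarrow>c. pochhammer (complex_of_real x) n)"
      by (simp add: o_def)
    show "fps_nth (G p) n = fps_nth (fps_hypergeo (map complex_of_real a) (map complex_of_real (b @ c)) 1) n"
      unfolding fps_hypergeo_nth_prod_list map_append prod_list.append a b c G_def fps_nth_Abs_fps prod_dividef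
      by (simp only: times_divide_eq_right divide_divide_eq_left mult_1_right mult.assoc)
  qed
  ultimately show ?thesis by (simp add: hypergeo_def[abs_def])
qed

section \<open>Real zeros force matched parameters\<close>

lemma cnj_eval_fps:
  assumes "fps_conv_radius f = \<infinity>" and "\<And>n. cnj (fps_nth f n) = fps_nth f n"
  shows "cnj (eval_fps f z) = eval_fps f (cnj z)"
proof -
  have "(\<lambda>n. cnj (fps_nth f n * z ^ n)) sums cnj (eval_fps f z)"
    unfolding sums_cnj using assms(1) by (intro sums_eval_fps) simp
  then show ?thesis
    using assms(2) by (simp add: sums_iff eval_fps_def)
qed

lemma poly_prod_list_one_minus:
  "poly (\<Prod>x\<leftarrow>xs. [:1, - inverse (complex_of_real x):]) z = (\<Prod>x\<leftarrow>xs. 1 - z / complex_of_real x)"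
  by (induction xs) (auto simp: divide_inverse algebra_simps)

lemma only_real_zeros_imp_matched:
  fixes a b :: "real list"
  assumes len: "length a = p" "length b = p" "p > 0"
    and a: "\<forall>x\<in>set a. x \<notin> \<int>\<^sub>\<le>\<^sub>0" and b: "\<forall>x\<in>set b. x \<notin> \<int>\<^sub>\<le>\<^sub>0"
    and real_zeros: "only_real_zeros (hypergeo (map complex_of_real a) (map complex_of_real b))"
  shows "\<exists>\<sigma>. \<sigma> permutes {..<p} \<and> (\<exists>m :: nat \<Rightarrow> nat. \<forall>i<p. a ! \<sigma> i = b ! i + real (m i))"
proof -
  define as bs where "as = map complex_of_real a" and "bs = map complex_of_real b"
  have as: "\<forall>x\<in>set as. x \<notin> \<int>\<^sub>\<le>\<^sub>0" and bs: "\<forall>x\<in>set bs. x \<notin> \<int>\<^sub>\<le>\<^sub>0" and len': "length as = p" "length bs = p"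
    using a b len by (auto simp: as_def bs_def)
  define g where "g = fps_hypergeo as bs 1"
  have g: "fps_conv_radius g = \<infinity>" and "\<exists>D\<ge>0. \<forall>z. norm (hypergeo as bs z) \<le> 1 * exp (D * norm z)"
    unfolding g_def using fps_hypergeo_entire[of as bs] bs len' by auto
  then obtain D where D: "D \<ge> 0" "\<And>z. norm (hypergeo as bs z) \<le> 1 * exp (D * norm z)" by blast
  have f: "hypergeo as bs = eval_fps g"
    by (simp add: hypergeo_def[abs_def] g_def)
  note rec = fps_hypergeo_recurrence[OF bs, of _ as, folded g_def]
  obtain C N where CN: "\<And>t. t \<ge> 1 \<Longrightarrow> (norm (eval_fps g (\<i> * of_real t)))\<^sup>2 \<le> C * t ^ N"
    using hypergeometric_imaginary_axis_bound[OF g len' len(3) rec] by blast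
  have real: "cnj (fps_nth g n) = fps_nth g n" for n
  proof -
    have "cnj (\<Prod>x\<leftarrow>map complex_of_real xs. pochhammer x n) = (\<Prod>x\<leftarrow>map complex_of_real xs. pochhammer x n)" for xs
      by (induction xs) (auto simp: pochhammer_of_real)
    then show ?thesis
      unfolding g_def fps_hypergeo_nth_prod_list as_def bs_def by simp
  qed
  \<comment> \<open>By conjugation the product is the squared norm at one point, for which the
    energy estimate is already at hand.\<close>
  have "norm (eval_fps g (\<i> * of_real y) * eval_fps g (- (\<i> * of_real y))) \<le> C * y ^ N" if "y \<ge> 1" for y
  proof -
    have "eval_fps g (- (\<i> * of_real y)) = cnj (eval_fps g (\<i> * of_real y))"
      using cnj_eval_fps[OF g real, of "\<i> * of_real y"] by simp
    then show ?thesis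
      using CN[OF that] by (simp add: norm_mult power2_eq_square)
  qed
  then obtain xs \<beta> where form: "\<And>z. eval_fps g z = (\<Prod>x\<leftarrow>xs. 1 - z / complex_of_real x) * exp (\<beta> * z)"
    using only_real_zeros_exp_type[of "eval_fps g" 1 D C N] D real_zeros hypergeo_0[of as bs] g
    unfolding as_def[symmetric] bs_def[symmetric] f
    by (metis holomorphic_on_eval_fps eball_inf order_refl)
  define P where "P = (\<Prod>x\<leftarrow>xs. [:1, - inverse (complex_of_real x):])"
  have "g = fps_of_poly P * fps_exp \<beta>"
  proof (rule eval_fps_eqD)
    have rad: "fps_conv_radius (fps_of_poly P * fps_exp \<beta>) = \<infinity>"
      using fps_conv_radius_mult[of "fps_of_poly P" "fps_exp \<beta>"] by simp
    show "fps_conv_radius g > 0" "fps_conv_radius (fps_of_poly P * fps_exp \<beta>) > 0"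
      using g rad by simp_all
    show "\<forall>\<^sub>F z in nhds 0. eval_fps g z = eval_fps (fps_of_poly P * fps_exp \<beta>) z"
      by (rule always_eventually)
        (simp add: form eval_fps_mult P_def poly_prod_list_one_minus)
  qed
  moreover have "fps_nth g n \<noteq> 0" for n
    unfolding g_def using as bs by (rule fps_hypergeo_nth_nonzero)
  ultimately obtain ms :: "nat list" where ms: "length ms = length bs" "mset as = mset (map2 (\<lambda>b m. b + of_nat m) bs ms)"
    using exp_form_imp_matching[of g P \<beta> as bs] len' rec by auto
  define ys where "ys = map2 (\<lambda>b m. b + real m) b ms"
  have "map2 (\<lambda>b m. b + of_nat m) bs ms = map complex_of_real ys"
    using ms(1) unfolding ys_def bs_def by (intro nth_equalityI) auto
  \<comment> \<open>Applying \<open>Re\<close> brings the matching, found among complex polynomials,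
    back to the real parameters.\<close>
  then have "image_mset Re (mset as) = image_mset Re (mset (map complex_of_real ys))"
    using ms(2) by simp
  then have "mset ys = mset a"
    by (simp add: as_def multiset.map_comp o_def)
  then obtain \<sigma> where \<sigma>: "\<sigma> permutes {..<length a}" "permute_list \<sigma> a = ys"
    by (rule mset_eq_permutation)
  have "a ! \<sigma> i = b ! i + real (ms ! i)" if "i < p" for i
  proof -
    have "a ! \<sigma> i = permute_list \<sigma> a ! i"
      using permute_list_nth[OF \<sigma>(1), of i] that len by simp
    also have "\<dots> = b ! i + real (ms ! i)"
      unfolding \<sigma>(2) ys_def using ms(1) that len len' by simp
    finally show ?thesis .
  qed
  then show ?thesis
    using \<sigma>(1) len by blast
qed

section \<open>Confluence of the additional parameters\<close>

text \<open>Rescaling the variable by the product of the large parameters turns the coefficient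
  \<open>1 / (d)\<^sub>n\<close> into \<open>d\<^sup>n / (d)\<^sub>n\<close>, which increases to 1.\<close>
lemma power_over_pochhammer:
  fixes d :: "nat \<Rightarrow> real" and x :: real
  shows "x > 0 \<Longrightarrow> x ^ n \<le> pochhammer x n"
    and "filterlim d at_top sequentially \<Longrightarrow> (\<lambda>N. d N ^ n / pochhammer (d N) n) \<longlonglongrightarrow> 1"
proof -
  show "x ^ n \<le> pochhammer x n" if "x > 0"
  proof -
    have "(\<Prod>i = 0..<n. x) \<le> (\<Prod>i = 0..<n. x + of_nat i)"
      using that by (intro prod_mono) auto
    then show ?thesis by (simp add: pochhammer_prod)
  qed
  assume d: "filterlim d at_top sequentially"
  have "((\<lambda>x::real. x / (x + real i)) \<longlongrightarrow> 1) at_top" for i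
    by real_asymp
  then have "(\<lambda>N. \<Prod>i = 0..<n. d N / (d N + real i)) \<longlonglongrightarrow> (\<Prod>i = 0..<n. 1)"
    by (intro tendsto_prod filterlim_compose[OF _ d])
  then show "(\<lambda>N. d N ^ n / pochhammer (d N) n) \<longlonglongrightarrow> 1"
    by (simp add: pochhammer_prod prod_dividef)
qed

text \<open>Dilation by the positive number \<open>s N\<close> keeps all zeros real. Because
  \<open>x ^ n \<le> pochhammer x n\<close>, the limit series \<open>g\<close> is itself a majorant
  of the dilated ones. For \<open>r = 0\<close> the product \<open>s N\<close> is empty and nothing
  is rescaled.\<close>

lemma only_real_zeros_confluence:
  fixes a b :: "real list" and c :: "nat \<Rightarrow> real list"
  assumes len: "length a = p" "length b = p" "p > 0"
    and a: "\<forall>x\<in>set a. x \<notin> \<int>\<^sub>\<le>\<^sub>0" and b: "\<forall>x\<in>set b. x \<notin> \<int>\<^sub>\<le>\<^sub>0"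
    and c: "\<And>n. length (c n) = r" "\<And>n x. x \<in> set (c n) \<Longrightarrow> x > 0"
    and lim: "\<And>j. j < r \<Longrightarrow> filterlim (\<lambda>n. c n ! j) at_top sequentially"
    and zeros: "\<And>n. only_real_zeros (hypergeo (map complex_of_real a) (map complex_of_real (b @ c n)))"
  shows "only_real_zeros (hypergeo (map complex_of_real a) (map complex_of_real b))"
proof -
  define as bs where "as = map complex_of_real a" and "bs = map complex_of_real b"
  define g where "g = fps_hypergeo as bs 1"
  define h where "h N = fps_hypergeo as (bs @ map complex_of_real (c N)) 1" for N
  define s where "s N = (\<Prod>j<r. c N ! j)" for N
  define u where "u N = Abs_fps (\<lambda>n. fps_nth (h N) n * of_real (s N) ^ n)" for N
  have c_pos: "c N ! j > 0" if "j < r" for N j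
    using c(1)[of N] c(2)[of "c N ! j" N] that by simp
  then have s_pos: "s N > 0" for N
    unfolding s_def by (intro prod_pos) auto
  have bs: "\<forall>x\<in>set bs. x \<notin> \<int>\<^sub>\<le>\<^sub>0" and as: "\<forall>x\<in>set as. x \<notin> \<int>\<^sub>\<le>\<^sub>0" and len': "length as = p" "length bs = p"
    using a b len by (auto simp: as_def bs_def)
  have g: "fps_conv_radius g = \<infinity>"
    unfolding g_def using bs len' by (intro fps_hypergeo_entire) auto
  have u_nth: "fps_nth (u N) n = fps_nth g n * of_real (\<Prod>j<r. (c N ! j) ^ n / pochhammer (c N ! j) n)" for N n
  proof -
    have "(\<Prod>x\<leftarrow>map complex_of_real (c N). pochhammer x n) = of_real (\<Prod>j<r. pochhammer (c N ! j) n)"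
      by (simp add: prod.list_conv_set_nth c(1) atLeast0LessThan pochhammer_of_real)
    then show ?thesis
      unfolding u_def h_def g_def s_def fps_nth_Abs_fps fps_hypergeo_nth_prod_list map_append prod_list.append
      by (simp add: prod_dividef prod_power_distrib)
  qed
  have quot: "0 \<le> (c N ! j) ^ n / pochhammer (c N ! j) n" "(c N ! j) ^ n / pochhammer (c N ! j) n \<le> 1" if "j < r" for N j n
    using c_pos[OF that, of N] pochhammer_pos[OF c_pos[OF that, of N], of n] power_over_pochhammer(1)[OF c_pos[OF that, of N], of n]
    by simp_all
  have bound: "norm (fps_nth (u N) n) \<le> norm (fps_nth g n)" for N n
  proof -
    have "0 \<le> (\<Prod>j<r. (c N ! j) ^ n / pochhammer (c N ! j) n)"
      using quot(1) by (intro prod_nonneg) auto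
    moreover have "(\<Prod>j<r. (c N ! j) ^ n / pochhammer (c N ! j) n) \<le> 1"
      using quot by (intro prod_le_1) auto
    ultimately have "\<bar>\<Prod>j<r. (c N ! j) ^ n / pochhammer (c N ! j) n\<bar> \<le> 1"
      by (simp only: abs_of_nonneg)
    then show ?thesis
      unfolding u_nth norm_mult norm_of_real by (intro mult_left_le) auto
  qed
  have lim_u: "(\<lambda>N. fps_nth (u N) n) \<longlonglongrightarrow> fps_nth g n" for n
  proof -
    have "(\<lambda>N. (c N ! j) ^ n / pochhammer (c N ! j) n) \<longlonglongrightarrow> 1" if "j < r" for j
      using power_over_pochhammer(2)[OF lim[OF that], of n] .
    then have "(\<lambda>N. \<Prod>j<r. (c N ! j) ^ n / pochhammer (c N ! j) n) \<longlonglongrightarrow> (\<Prod>j<r. 1)"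
      by (intro tendsto_prod) auto
    then have "(\<lambda>N. fps_nth g n * of_real (\<Prod>j<r. (c N ! j) ^ n / pochhammer (c N ! j) n)) \<longlonglongrightarrow> fps_nth g n * of_real (\<Prod>j<r. 1)"
      by (rule tendsto_mult[OF tendsto_const tendsto_of_real])
    then show ?thesis by (simp only: u_nth prod.neutral_const of_real_1 mult_1_right)
  qed
  have unif: "uniform_limit (cball 0 R) (\<lambda>N. eval_fps (u N)) (eval_fps g) sequentially" for R
    by (rule uniform_limit_eval_fps[OF lim_u bound g])
  have "only_real_zeros (eval_fps g)"
  proof (rule only_real_zeros_limit[where F = "\<lambda>N. eval_fps (u N)"])
    show "only_real_zeros (eval_fps (u N))" for N
      unfolding only_real_zeros_def
    proof (intro allI impI)
      fix z assume "eval_fps (u N) z = 0"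
      then have "eval_fps (h N) (of_real (s N) * z) = 0"
        by (simp only: u_def eval_fps_dilate)
      then have "hypergeo as (map complex_of_real (b @ c N)) (of_real (s N) * z) = 0"
        by (simp only: hypergeo_def h_def bs_def map_append)
      then have "of_real (s N) * z \<in> \<real>"
        using zeros[of N] unfolding only_real_zeros_def as_def by blast
      then have "of_real (s N) * z / of_real (s N) \<in> \<real>"
        by (intro Reals_divide) auto
      then show "z \<in> \<real>" using s_pos[of N] by simp
    qed
    show "eval_fps (u N) holomorphic_on UNIV" for N
      by (rule holomorphic_on_eval_fps) (simp add: fps_conv_radius_eq_infinityI[OF g bound])
    show "eval_fps g holomorphic_on UNIV"
      by (rule holomorphic_on_eval_fps) (simp add: g)
    show "\<not> eval_fps g constant_on UNIV"
      using hypergeo_nonconstant[of as bs] as bs len' by (simp add: hypergeo_def[abs_def] g_def)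
  qed (rule unif)
  then show ?thesis
    by (simp add: hypergeo_def[abs_def] g_def as_def bs_def)
qed

theorem theorem5:
  fixes p q :: nat and a b :: "real list"
  assumes "1 \<le> p" and "p \<le> q"
    and "length a = p" and "\<forall>x\<in>set a. x \<notin> \<int>\<^sub>\<le>\<^sub>0"
    and "length b = p" and "\<forall>x\<in>set b. x > 0"
  shows
    "let F = (\<lambda>c :: real list. hypergeo (map complex_of_real a) (map complex_of_real (b @ c)));
         for_all_positive = (\<lambda>Q :: real list \<Rightarrow> bool.
           \<forall>c. length c = q - p \<and> (\<forall>x\<in>set c. x > 0) \<longrightarrow> Q c);
         for_all_large = (\<lambda>Q :: real list \<Rightarrow> bool.
           \<exists>B>0. \<forall>c. length c = q - p \<and> (\<forall>x\<in>set c. x \<ge> B) \<longrightarrow> Q c);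
         along_some_sequence = (\<lambda>Q :: real list \<Rightarrow> bool.
           \<exists>c :: nat \<Rightarrow> real list.
             (\<forall>n. length (c n) = q - p \<and> (\<forall>x\<in>set (c n). x \<notin> \<int>\<^sub>\<le>\<^sub>0)) \<and>
             (\<forall>j<q - p. filterlim (\<lambda>n. c n ! j) at_top sequentially) \<and>
             (\<forall>n. Q (c n)));
         A = for_all_positive (\<lambda>c. only_real_zeros (F c));
         A' = for_all_large (\<lambda>c. only_real_zeros (F c));
         A'' = along_some_sequence (\<lambda>c. only_real_zeros (F c));
         B = for_all_positive (\<lambda>c. F c \<in> LP_plus);
         B' = for_all_large (\<lambda>c. F c \<in> LP_plus);
         B'' = along_some_sequence (\<lambda>c. F c \<in> LP_plus);
         C = (\<exists>\<sigma>. \<sigma> permutes {..<p} \<and>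
                (\<exists>m :: nat \<Rightarrow> nat. \<forall>i<p. a ! \<sigma> i = b ! i + real (m i)))
     in (A \<longleftrightarrow> A') \<and> (A' \<longleftrightarrow> A'') \<and> (A'' \<longleftrightarrow> B) \<and> (B \<longleftrightarrow> B') \<and> (B' \<longleftrightarrow> B'') \<and> (B'' \<longleftrightarrow> C)"
proof -
  define F where "F = (\<lambda>c :: real list. hypergeo (map complex_of_real a) (map complex_of_real (b @ c)))"
  define pos where "pos Q \<longleftrightarrow> (\<forall>c. length c = q - p \<and> (\<forall>x\<in>set c. x > 0) \<longrightarrow> Q c)" for Q :: "real list \<Rightarrow> bool"
  define large where "large Q \<longleftrightarrow> (\<exists>B>0. \<forall>c. length c = q - p \<and> (\<forall>x\<in>set c. x \<ge> B) \<longrightarrow> Q c)" for Q :: "real list \<Rightarrow> bool"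
  define seq where "seq Q \<longleftrightarrow> (\<exists>c :: nat \<Rightarrow> real list.
             (\<forall>n. length (c n) = q - p \<and> (\<forall>x\<in>set (c n). x \<notin> \<int>\<^sub>\<le>\<^sub>0)) \<and>
             (\<forall>j<q - p. filterlim (\<lambda>n. c n ! j) at_top sequentially) \<and>
             (\<forall>n. Q (c n)))" for Q
  define C where "C \<longleftrightarrow> (\<exists>\<sigma>. \<sigma> permutes {..<p} \<and> (\<exists>m :: nat \<Rightarrow> nat. \<forall>i<p. a ! \<sigma> i = b ! i + real (m i)))"
  have a: "\<forall>x\<in>set a. x \<notin> \<int>\<^sub>\<le>\<^sub>0" and b: "\<forall>x\<in>set b. x \<notin> \<int>\<^sub>\<le>\<^sub>0" and p: "p > 0"
    using assms pos_not_nonpos_Ints by auto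
  have large_if_pos: "large Q" if "pos Q" for Q
    using that unfolding pos_def large_def by (intro exI[of _ 1]) (auto intro: less_le_trans[OF zero_less_one])
  have seq_if_large: "seq Q" if "large Q" for Q
  proof -
    obtain B where B: "B > 0" "\<And>c. length c = q - p \<Longrightarrow> \<forall>x\<in>set c. x \<ge> B \<Longrightarrow> Q c"
      using \<open>large Q\<close> unfolding large_def by blast
    define c where "c n = replicate (q - p) (B + real n)" for n
    have "filterlim (\<lambda>n. B + real n) at_top sequentially"
      by (rule filterlim_tendsto_add_at_top[OF tendsto_const filterlim_real_sequentially])
    then show ?thesis
      unfolding seq_def using B pos_not_nonpos_Ints[of "B + real n" for n]
      by (intro exI[of _ c]) (auto simp: c_def)
  qed
  have LP_imp: "only_real_zeros (F c)" if "F c \<in> LP_plus" "length c = q - p" "\<forall>x\<in>set c. x \<notin> \<int>\<^sub>\<le>\<^sub>0" for c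
    unfolding F_def
  proof (rule LP_plus_only_real_zeros)
    show "\<not> hypergeo (map complex_of_real a) (map complex_of_real (b @ c)) constant_on UNIV"
      by (rule hypergeo_nonconstant) (use that a b assms in auto)
  qed (use that in \<open>simp_all add: F_def hypergeo_0\<close>)
  have CB: "pos (\<lambda>c. F c \<in> LP_plus)" if C
    using that LP_plus_hypergeo_matched[OF assms(3,5,6)] unfolding pos_def C_def F_def by blast
  have BA: "pos (\<lambda>c. only_real_zeros (F c))" if "pos (\<lambda>c. F c \<in> LP_plus)"
    using that LP_imp pos_not_nonpos_Ints unfolding pos_def by blast
  have BA'': "seq (\<lambda>c. only_real_zeros (F c))" if "seq (\<lambda>c. F c \<in> LP_plus)"
    using that LP_imp unfolding seq_def by blast
  have AC: C if "seq (\<lambda>c. only_real_zeros (F c))"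
  proof -
    obtain c where c: "\<And>n. length (c n) = q - p" "\<And>j. j < q - p \<Longrightarrow> filterlim (\<lambda>n. c n ! j) at_top sequentially"
      "\<And>n. only_real_zeros (F (c n))"
      using \<open>seq _\<close> unfolding seq_def by blast
    \<comment> \<open>The tuples of the given sequence may have negative entries at first;
      divergence to infinity leaves finitely many of those, and the sequence is started after
      them.\<close>
    have "\<forall>\<^sub>F n in sequentially. \<forall>j\<in>{..<q - p}. c n ! j > 0"
      using c(2) by (intro eventually_ball_finite) (auto simp: filterlim_at_top_dense)
    then obtain N where N: "\<And>n j. n \<ge> N \<Longrightarrow> j < q - p \<Longrightarrow> c n ! j > 0"
      by (auto simp: eventually_sequentially)
    have "only_real_zeros (hypergeo (map complex_of_real a) (map complex_of_real b))"
    proof (rule only_real_zeros_confluence[OF assms(3,5) p a b, where c = "\<lambda>n. c (n + N)"])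
      show "filterlim (\<lambda>n. c (n + N) ! j) at_top sequentially" if "j < q - p" for j
        using c(2)[OF that] by (rule filterlim_compose) (rule filterlim_add_const_nat_at_top)
    qed (use c N in \<open>auto simp: in_set_conv_nth F_def\<close>)
    then show C
      unfolding C_def by (rule only_real_zeros_imp_matched[OF assms(3,5) p a b])
  qed
  note defs = F_def pos_def large_def seq_def C_def
  \<comment> \<open>The implications close up as (c) => (b) => (b') => (b'') => (a'') => (c), with
    (b) => (a) => (a') => (a'') attached.\<close>
  have "(pos (\<lambda>c. only_real_zeros (F c)) \<longleftrightarrow> large (\<lambda>c. only_real_zeros (F c))) \<and>
    (large (\<lambda>c. only_real_zeros (F c)) \<longleftrightarrow> seq (\<lambda>c. only_real_zeros (F c))) \<and>
    (seq (\<lambda>c. only_real_zeros (F c)) \<longleftrightarrow> pos (\<lambda>c. F c \<in> LP_plus)) \<and>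
    (pos (\<lambda>c. F c \<in> LP_plus) \<longleftrightarrow> large (\<lambda>c. F c \<in> LP_plus)) \<and>
    (large (\<lambda>c. F c \<in> LP_plus) \<longleftrightarrow> seq (\<lambda>c. F c \<in> LP_plus)) \<and>
    (seq (\<lambda>c. F c \<in> LP_plus) \<longleftrightarrow> C)"
    using large_if_pos seq_if_large CB BA BA'' AC by blast
  then show ?thesis
    unfolding Let_def defs .
qed

end
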